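(* Let $k\in\{0,\ldots,n-1\}$ and let $N^{k+1},\ldots,N^n$ be $\mathcal F_k$-measurable random variables. Then $V_k(N^{k+1},\ldots,N^n)$ equals the essential infimum of all $M_k\in\mathcal F_k$ such that there exist $M_{k+1}\in\mathcal F_{k+1}$ and a family of $\mathbb P$-supermartingales $(N^{k+1}_t)_{t=k}^{k+1},\ldots,(N^{n}_t)_{t=k}^{n}$ which satisfy the following conditions: $$\begin{cases} \mathbb E^{\mathbb Q}[M_{k+1}|\mathcal F_k]=M_k,\\ N_k^i=N^i \text{ for } i\in\{k+1,\ldots,n\},\\ N_{k+1}^{k+1}\geq l(M_{k+1}-S_{k+1}),\\ M_{k+1}\geq V_{k+1}(N_{k+1}^{k+2},\ldots,N_{k+1}^n). \end{cases}$$
   Context: Setting: $(\Omega,\mathcal F,\mathbb P)$ is a probability space with a discrete filtration $\mathbb F=(\mathcal F_k)_{k=0}^n$, $n\ge 1$, with $\mathcal F_0$ trivial; $\mathbb Q$ is a probability measure equivalent to $\mathbb P$; $S_0=0$ and $S_k=P_1+\dots+P_k$, where each $P_i$ is $\mathcal F_i$-measurable with $\mathbb E^{\mathbb Q}[|P_i|]<\infty$. The loss function $l:\mathbf R\to\mathbf R$ is convex, decreasing (in the weak sense) and bounded from below. All super/martingales are with respect to $\mathbb F$; a $\mathbb Q$-supermartingale (resp. $\mathbb P$-supermartingale) is a supermartingale under $\mathbb Q$ (resp. $\mathbb P$). The notation $M\in\mathcal F_k$ means that $M$ is an $\mathcal F_k$-measurable random variable. Value function (European-style constraint): for $k\in\{0,\ldots,n-1\}$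 and $\mathcal F_k$-measurable random variables $N^{k+1},\ldots,N^n$, $V_k(N^{k+1},\ldots,N^n)$ is the essential infimum of all $M_k\in\mathcal F_k$ such that there exists a $\mathbb Q$-supermartingale $(M_t)_{t=k}^n$ (starting from this $M_k$) with $\mathbb E^{\mathbb P}[l(M_t-S_t)|\mathcal F_k]\leq N^t$ for all $t\in\{k+1,\ldots,n\}$. By convention $V_n=-\infty$ (with no arguments).
   Formalization: The claim fails for non-integrable N^i if P-supermartingales must be integrable; it is proved for all N^i with P-supermartingales whose conditional expectations of |N^i_t| are merely a.s. finite, and for P-integrable N^i with usual P-supermartingales. *)

theory Defs
  imports "HOL-Probability.Probability"
begin

section \<open>Essential infimum of a family of random variables\<close>

text \<open>
  This is the essential infimum of a family, i.e. its greatest almost sure lower bound, and not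
  the essential infimum over the sample space of a single function. Lower bounds are
  extended real valued, so that the essential infimum of the empty family is \<open>\<infinity>\<close>.
\<close>

definition is_ess_inf :: "'a measure \<Rightarrow> ('a \<Rightarrow> real) set \<Rightarrow> ('a \<Rightarrow> ereal) \<Rightarrow> bool" where
  "is_ess_inf M \<Phi> Y \<longleftrightarrow>
     Y \<in> borel_measurable M \<and>
     (\<forall>X\<in>\<Phi>. AE \<omega> in M. Y \<omega> \<le> ereal (X \<omega>)) \<and>
     (\<forall>Z\<in>borel_measurable M. (\<forall>X\<in>\<Phi>. AE \<omega> in M. Z \<omega> \<le> ereal (X \<omega>)) \<longrightarrow> (AE \<omega> in M. Z \<omega> \<le> Y \<omega>))"

text \<open>
  A version of the essential infimum. It is determined only up to null sets (lemma
  \<open>is_ess_inf_unique\<close>), and it exists for every family of random variables (lemma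
  \<open>is_ess_inf_ess_inf\<close>).
\<close>

definition ess_inf :: "'a measure \<Rightarrow> ('a \<Rightarrow> real) set \<Rightarrow> 'a \<Rightarrow> ereal" where
  "ess_inf M \<Phi> = (SOME Y. is_ess_inf M \<Phi> Y)"

lemma is_ess_inf_unique:
  assumes "is_ess_inf M \<Phi> Y" "is_ess_inf M \<Phi> Y'"
  shows "AE \<omega> in M. Y \<omega> = Y' \<omega>"
proof -
  have "AE \<omega> in M. Y \<omega> \<le> Y' \<omega>" "AE \<omega> in M. Y' \<omega> \<le> Y \<omega>"
    using assms unfolding is_ess_inf_def by blast+
  then show ?thesis by eventually_elim auto
qed

lemma (in prob_space) ex_is_ess_inf:
  assumes meas: "\<Phi> \<subseteq> borel_measurable M"
  shows "\<exists>Y. is_ess_inf M \<Phi> Y"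
proof (cases "\<Phi> = {}")
  case True
  then show ?thesis
    by (intro exI[of _ "\<lambda>_. \<infinity>"]) (auto simp: is_ess_inf_def)
next
  case False
  then obtain X0 where X0: "X0 \<in> \<Phi>" by auto
  define g where "g C \<omega> = (INF X\<in>C. arctan (X \<omega>))" for C :: "('a \<Rightarrow> real) set" and \<omega>
  define J where "J C = (\<integral>\<omega>. g C \<omega> \<partial>M)" for C
  define \<C> where "\<C> = {C. C \<subseteq> \<Phi> \<and> countable C \<and> X0 \<in> C}"
  have \<C>_ne: "\<C> \<noteq> {}" using X0 by (auto simp: \<C>_def intro!: exI[of _ "{X0}"])
  have bdd: "bdd_below ((\<lambda>X. arctan (X \<omega>)) ` C)" for C :: "('a \<Rightarrow> real) set" and \<omega>
    by (intro bdd_belowI2[of _ "-2"]) (use arctan_lbound pi_less_4 in \<open>smt (verit) field_sum_of_halves\<close>)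
  have g_le: "g C \<omega> \<le> arctan (X \<omega>)" if "X \<in> C" for C X \<omega>
    unfolding g_def using that by (intro cINF_lower bdd)
  have g_ge: "-2 \<le> g C \<omega>" if "C \<in> \<C>" for C \<omega>
    unfolding g_def
    by (intro cINF_greatest)
       (use that arctan_lbound pi_less_4 in \<open>auto simp: \<C>_def, smt (verit) field_sum_of_halves\<close>)
  have g_meas: "g C \<in> borel_measurable M" if "C \<in> \<C>" for C
    unfolding g_def using that meas
    by (intro borel_measurable_cINF) (auto simp: \<C>_def bdd)
  have g_int: "integrable M (g C)" if "C \<in> \<C>" for C
  proof (rule integrable_const_bound[where B = 2])
    show "AE \<omega> in M. norm (g C \<omega>) \<le> 2"
    proof (rule AE_I2)
      fix \<omega>
      have "g C \<omega> \<le> arctan (X0 \<omega>)" using that by (intro g_le) (auto simp: \<C>_def)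
      moreover have "arctan (X0 \<omega>) < 2"
        using arctan_ubound[of "X0 \<omega>"] pi_less_4 by linarith
      ultimately show "norm (g C \<omega>) \<le> 2" using g_ge[OF that, of \<omega>] by auto
    qed
  qed (use that g_meas in auto)
  have J_ge: "-2 \<le> J C" if "C \<in> \<C>" for C
    using integral_mono[OF _ g_int[OF that], of "\<lambda>_. -2"] g_ge[OF that]
    by (simp add: J_def prob_space)
  have J_bdd: "bdd_below (J ` \<C>)" using J_ge by (intro bdd_belowI2[of _ "-2"]) auto
  define I where "I = (INF C\<in>\<C>. J C)"
  have "\<exists>C\<in>\<C>. J C < I + 1 / real (Suc m)" for m
  proof -
    have "Inf (J ` \<C>) < I + 1 / real (Suc m)" by (simp add: I_def)
    then show ?thesis using cINF_less_iff[OF \<C>_ne J_bdd] by blast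
  qed
  then obtain C where C: "\<And>m. C m \<in> \<C>" "\<And>m. J (C m) < I + 1 / real (Suc m)" by metis
  define D where "D = (\<Union>m. C m)"
  have D: "D \<in> \<C>" using C(1) by (auto simp: D_def \<C>_def)
  have g_anti: "g B \<omega> \<le> g A \<omega>" if "A \<subseteq> B" "A \<in> \<C>" for A B \<omega>
    unfolding g_def using that by (intro cINF_superset_mono bdd) (auto simp: \<C>_def)
  have J_anti: "J B \<le> J A" if "A \<subseteq> B" "A \<in> \<C>" "B \<in> \<C>" for A B
    unfolding J_def using that by (intro integral_mono g_int g_anti)
  have JD: "J D \<le> I"
  proof (rule field_le_epsilon)
    fix e :: real assume "e > 0"
    then obtain m where "inverse (real (Suc m)) < e" using reals_Archimedean by blast
    moreover have "J D \<le> J (C m)" by (intro J_anti C D) (auto simp: D_def)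
    ultimately show "J D \<le> I + e" using C(2)[of m] by (simp add: inverse_eq_divide)
  qed
  define Y where "Y \<omega> = (INF X\<in>D. ereal (X \<omega>))" for \<omega>
  have D_sub: "D \<subseteq> \<Phi>" "countable D" "D \<noteq> {}" using D by (auto simp: \<C>_def)
  have "is_ess_inf M \<Phi> Y"
    unfolding is_ess_inf_def
  proof (intro conjI ballI impI)
    show "Y \<in> borel_measurable M"
      unfolding Y_def using D_sub meas by (intro borel_measurable_INF) auto
  next
    fix X assume X: "X \<in> \<Phi>"
    define D' where "D' = insert X D"
    have D': "D' \<in> \<C>" using D X by (auto simp: \<C>_def D'_def)
    have le: "g D' \<omega> \<le> g D \<omega>" for \<omega> using D by (intro g_anti) (auto simp: D'_def)
    have "I \<le> J D'" unfolding I_def by (intro cINF_lower J_bdd D')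
    with JD have "J D \<le> J D'" by simp
    moreover have "J D' \<le> J D" using D D' by (intro J_anti) (auto simp: D'_def)
    ultimately have "(\<integral>\<omega>. g D \<omega> - g D' \<omega> \<partial>M) = 0"
      using g_int[OF D] g_int[OF D'] by (simp add: J_def)
    then have "AE \<omega> in M. g D \<omega> - g D' \<omega> = 0"
      using integral_nonneg_eq_0_iff_AE[of M "\<lambda>\<omega>. g D \<omega> - g D' \<omega>"] g_int[OF D] g_int[OF D'] le
      by auto
    then show "AE \<omega> in M. Y \<omega> \<le> ereal (X \<omega>)"
    proof eventually_elim
      case (elim \<omega>)
      have *: "g D \<omega> \<le> arctan (X \<omega>)" using elim g_le[of X D' \<omega>] by (simp add: D'_def)
      show "Y \<omega> \<le> ereal (X \<omega>)"
      proof (rule ereal_le_epsilon2)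
        fix e :: real assume "e > 0"
        then have "g D \<omega> < arctan (X \<omega> + e)" using * arctan_less_iff[of "X \<omega>" "X \<omega> + e"] by simp
        then obtain X' where "X' \<in> D" "arctan (X' \<omega>) < arctan (X \<omega> + e)"
          unfolding g_def using cINF_less_iff[OF D_sub(3) bdd] by blast
        then show "Y \<omega> \<le> ereal (X \<omega>) + ereal e"
          unfolding Y_def by (intro INF_lower2[of X']) (auto simp: arctan_less_iff)
      qed
    qed
  next
    fix Z assume "\<forall>X\<in>\<Phi>. AE \<omega> in M. Z \<omega> \<le> ereal (X \<omega>)"
    then have "\<forall>X\<in>D. AE \<omega> in M. Z \<omega> \<le> ereal (X \<omega>)" using D_sub by auto
    then have "AE \<omega> in M. \<forall>X\<in>D. Z \<omega> \<le> ereal (X \<omega>)"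
      by (simp add: AE_ball_countable[OF D_sub(2)])
    then show "AE \<omega> in M. Z \<omega> \<le> Y \<omega>"
      by eventually_elim (auto simp: Y_def intro: INF_greatest)
  qed
  then show ?thesis by blast
qed

lemma (in prob_space) is_ess_inf_ess_inf:
  "\<Phi> \<subseteq> borel_measurable M \<Longrightarrow> is_ess_inf M \<Phi> (ess_inf M \<Phi>)"
  unfolding ess_inf_def by (rule someI_ex[OF ex_is_ess_inf])


section \<open>Conditional expectations and supermartingales\<close>

text \<open>
  The library function \<^const>\<open>real_cond_exp\<close> is meaningful only if the positive and negative parts have
  finite conditional expectations (an infinite value is turned into 0). The version below
  is also correct when just one of them is finite, e.g. for random variables bounded from below;
  its value may then be infinite.
\<close>

definition ext_cond_exp :: "'a measure \<Rightarrow> 'a measure \<Rightarrow> ('a \<Rightarrow> real) \<Rightarrow> 'a \<Rightarrow> ereal" where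
  "ext_cond_exp M G X \<omega> =
     enn2ereal (nn_cond_exp M G (\<lambda>\<omega>. ennreal (X \<omega>)) \<omega>)
     - enn2ereal (nn_cond_exp M G (\<lambda>\<omega>. ennreal (- X \<omega>)) \<omega>)"

definition supermartingale ::
  "'a measure \<Rightarrow> (nat \<Rightarrow> 'a measure) \<Rightarrow> nat \<Rightarrow> nat \<Rightarrow> (nat \<Rightarrow> 'a \<Rightarrow> real) \<Rightarrow> bool" where
  "supermartingale M F a b X \<longleftrightarrow>
     (\<forall>t\<in>{a..b}. X t \<in> borel_measurable (F t) \<and> integrable M (X t)) \<and>
     (\<forall>s\<in>{a..b}. \<forall>t\<in>{s..b}. AE \<omega> in M. real_cond_exp M (F s) (X t) \<omega> \<le> X s \<omega>)"

text \<open>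
  A supermartingale in the generalized sense: integrability is replaced by almost sure finiteness of the
  conditional expectations of \<open>\<bar>X\<^sub>t\<bar>\<close>. It makes sense for processes whose
  initial value is an arbitrary random variable, which need not be integrable.
\<close>

definition generalized_supermartingale ::
  "'a measure \<Rightarrow> (nat \<Rightarrow> 'a measure) \<Rightarrow> nat \<Rightarrow> nat \<Rightarrow> (nat \<Rightarrow> 'a \<Rightarrow> real) \<Rightarrow> bool" where
  "generalized_supermartingale M F a b X \<longleftrightarrow>
     (\<forall>t\<in>{a..b}. X t \<in> borel_measurable (F t)) \<and>
     (\<forall>s\<in>{a..b}. \<forall>t\<in>{s..b}.
        (AE \<omega> in M. nn_cond_exp M (F s) (\<lambda>\<omega>. ennreal \<bar>X t \<omega>\<bar>) \<omega> < \<infinity>) \<and>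
        (AE \<omega> in M. ext_cond_exp M (F s) (X t) \<omega> \<le> ereal (X s \<omega>)))"


section \<open>The value function and the one-step problem\<close>

text \<open>
  The arguments \<open>N\<^sup>k\<^sup>+\<^sup>1, \<dots>, N\<^sup>n\<close> form a family \<open>N\<close> indexed by \<^typ>\<open>nat\<close>, of which only the members with index
  in \<open>{k+1..n}\<close> matter.
\<close>

definition admissible_values ::
  "'a measure \<Rightarrow> 'a measure \<Rightarrow> (nat \<Rightarrow> 'a measure) \<Rightarrow> (nat \<Rightarrow> 'a \<Rightarrow> real) \<Rightarrow> (real \<Rightarrow> real) \<Rightarrow> nat \<Rightarrow>
   nat \<Rightarrow> (nat \<Rightarrow> 'a \<Rightarrow> real) \<Rightarrow> ('a \<Rightarrow> real) set" where
  "admissible_values P Q F S l n k N =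
     {M\<^sub>k \<in> borel_measurable (F k). \<exists>M.
        M k = M\<^sub>k \<and>
        supermartingale Q F k n M \<and>
        (\<forall>t\<in>{k+1..n}. AE \<omega> in P. ext_cond_exp P (F k) (\<lambda>\<omega>. l (M t \<omega> - S t \<omega>)) \<omega> \<le> ereal (N t \<omega>))}"

definition value_function ::
  "'a measure \<Rightarrow> 'a measure \<Rightarrow> (nat \<Rightarrow> 'a measure) \<Rightarrow> (nat \<Rightarrow> 'a \<Rightarrow> real) \<Rightarrow> (real \<Rightarrow> real) \<Rightarrow> nat \<Rightarrow>
   nat \<Rightarrow> (nat \<Rightarrow> 'a \<Rightarrow> real) \<Rightarrow> 'a \<Rightarrow> ereal" where
  "value_function P Q F S l n k N =
     (if k < n then ess_inf P (admissible_values P Q F S l n k N) else (\<lambda>_. -\<infinity>))"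

text \<open>
  The admissible initial values of the one-step problem. The parameter \<open>SM\<close> is the notion of
  supermartingale required of \<open>(N\<^sup>i\<^sub>t)\<close> for \<open>t = k, \<dots>, i\<close>; this process is written \<open>NN i\<close>, with \<open>NN i t\<close> its value
  at time \<open>t\<close>.
\<close>

definition one_step_values ::
  "('a measure \<Rightarrow> (nat \<Rightarrow> 'a measure) \<Rightarrow> nat \<Rightarrow> nat \<Rightarrow> (nat \<Rightarrow> 'a \<Rightarrow> real) \<Rightarrow> bool) \<Rightarrow>
   'a measure \<Rightarrow> 'a measure \<Rightarrow> (nat \<Rightarrow> 'a measure) \<Rightarrow> (nat \<Rightarrow> 'a \<Rightarrow> real) \<Rightarrow> (real \<Rightarrow> real) \<Rightarrow> nat \<Rightarrow>
   nat \<Rightarrow> (nat \<Rightarrow> 'a \<Rightarrow> real) \<Rightarrow> ('a \<Rightarrow> real) set" where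
  "one_step_values SM P Q F S l n k N =
     {M\<^sub>k \<in> borel_measurable (F k). \<exists>M' NN.
        M' \<in> borel_measurable (F (k+1)) \<and> integrable Q M' \<and>
        (\<forall>i\<in>{k+1..n}. SM P F k i (NN i)) \<and>
        (AE \<omega> in P. real_cond_exp Q (F k) M' \<omega> = M\<^sub>k \<omega>) \<and>
        (\<forall>i\<in>{k+1..n}. AE \<omega> in P. NN i k \<omega> = N i \<omega>) \<and>
        (AE \<omega> in P. NN (k+1) (k+1) \<omega> \<ge> l (M' \<omega> - S (k+1) \<omega>)) \<and>
        (AE \<omega> in P. ereal (M' \<omega>) \<ge> value_function P Q F S l n (k+1) (\<lambda>i. NN i (k+1)) \<omega>)}"

end

theory Submission
  imports Defs
begin

text \<open>
  Every value admissible for the original problem is admissible for the one-step problem: after adding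
  the first increment of its compensator to all later values, the supermartingale \<open>M\<close> satisfies
  \<open>E\<^sup>Q[M\<^sub>k\<^sub>+\<^sub>1 | F\<^sub>k] = M\<^sub>k\<close> and has smaller losses, and \<open>N\<^sup>i\<^sub>t = E\<^sup>P[l(M\<^sub>i - S\<^sub>i) | F\<^sub>t]\<close> (with \<open>N\<^sup>i\<^sub>k = N\<^sup>i\<close>) are the required
  processes.

  Conversely, let \<open>M\<^sub>k\<^sub>+\<^sub>1\<close> solve the one-step problem. The admissible values at time \<open>k + 1\<close> are closed
  under minima (glue two supermartingales along a set in \<open>F\<^sub>k\<^sub>+\<^sub>1\<close>) and their essential infimum is at most
  \<open>M\<^sub>k\<^sub>+\<^sub>1\<close>, so there are admissible \<open>Y \<ge> M\<^sub>k\<^sub>+\<^sub>1\<close> with \<open>E\<^sup>Q[Y]\<close> arbitrarily close to \<open>E\<^sup>Q[M\<^sub>k\<^sub>+\<^sub>1]\<close>. Then \<open>E\<^sup>Q[Y | F\<^sub>k]\<close>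
  is admissible at time \<open>k\<close> and converges to \<open>M\<^sub>k\<close> in mean. Only finitely many supermartingales are ever glued,
  which preserves integrability.
\<close>

section \<open>Extended conditional expectations\<close>

context sigma_finite_subalgebra
begin

section \<open>Locality and monotonicity of conditional expectations\<close>

text \<open>The indicator of a set in \<open>F\<close> can be pulled out of the conditional
  expectation. Hence on \<open>A\<close> only the values of \<open>f\<close> count, and on the
  complement only those of \<open>g\<close>. This is what makes gluing along an event
  possible.\<close>

lemma nn_cond_exp_If:
  assumes A: "A \<in> sets F" and [measurable]: "f \<in> borel_measurable M" "g \<in> borel_measurable M"
  shows "AE x in M. nn_cond_exp M F (\<lambda>x. if x \<in> A then f x else g x) x =
    (if x \<in> A then nn_cond_exp M F f x else nn_cond_exp M F g x)"
proof -
  define h where "h x = (if x \<in> A then f x else g x)" for x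
  have [measurable]: "A \<in> sets F" "A \<in> sets M"
    using A subalg by (auto simp: subalgebra_def)
  have [measurable]: "h \<in> borel_measurable M" unfolding h_def by measurable
  have *: "AE x in M. indicator B x * nn_cond_exp M F h x = indicator B x * nn_cond_exp M F f' x"
    if B[measurable]: "B \<in> sets F" and [measurable]: "f' \<in> borel_measurable M"
      and eq: "\<And>x. x \<in> B \<Longrightarrow> h x = f' x" for B f'
  proof -
    have "(\<lambda>x. indicator B x * h x) = (\<lambda>x. indicator B x * f' x)"
      using eq by (auto simp: indicator_def)
    then show ?thesis
      using nn_cond_exp_prod[of "indicator B" h] nn_cond_exp_prod[of "indicator B" f'] by auto
  qed
  have "AE x in M. indicator A x * nn_cond_exp M F h x = indicator A x * nn_cond_exp M F f x"
    by (rule *) (auto simp: h_def)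
  moreover have "AE x in M. indicator (space F - A) x * nn_cond_exp M F h x =
      indicator (space F - A) x * nn_cond_exp M F g x"
    by (rule *) (auto simp: h_def)
  ultimately show ?thesis
    using AE_space unfolding h_def[symmetric]
    by eventually_elim (use subalg in \<open>auto simp: subalgebra_def indicator_def split: if_splits\<close>)
qed

lemma real_cond_exp_If:
  assumes A: "A \<in> sets F" and [measurable]: "f \<in> borel_measurable M" "g \<in> borel_measurable M"
  shows "AE x in M. real_cond_exp M F (\<lambda>x. if x \<in> A then f x else g x) x =
    (if x \<in> A then real_cond_exp M F f x else real_cond_exp M F g x)"
  using nn_cond_exp_If[of A "\<lambda>x. ennreal (f x)" "\<lambda>x. ennreal (g x)", OF A]
    nn_cond_exp_If[of A "\<lambda>x. ennreal (- f x)" "\<lambda>x. ennreal (- g x)", OF A]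
  by (auto simp: real_cond_exp_def if_distrib[of ennreal] if_distrib[of uminus])

lemma ext_cond_exp_If:
  assumes A: "A \<in> sets F" and [measurable]: "f \<in> borel_measurable M" "g \<in> borel_measurable M"
  shows "AE x in M. ext_cond_exp M F (\<lambda>x. if x \<in> A then f x else g x) x =
    (if x \<in> A then ext_cond_exp M F f x else ext_cond_exp M F g x)"
  using nn_cond_exp_If[of A "\<lambda>x. ennreal (f x)" "\<lambda>x. ennreal (g x)", OF A]
    nn_cond_exp_If[of A "\<lambda>x. ennreal (- f x)" "\<lambda>x. ennreal (- g x)", OF A]
  by (auto simp: ext_cond_exp_def if_distrib[of ennreal] if_distrib[of uminus])

lemma ext_cond_exp_mono:
  assumes "AE x in M. f x \<le> g x" and [measurable]: "f \<in> borel_measurable M" "g \<in> borel_measurable M"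
  shows "AE x in M. ext_cond_exp M F f x \<le> ext_cond_exp M F g x"
proof -
  have "AE x in M. nn_cond_exp M F (\<lambda>x. ennreal (f x)) x \<le> nn_cond_exp M F (\<lambda>x. ennreal (g x)) x"
    by (rule nn_cond_exp_mono, use assms(1) in eventually_elim) (auto intro: ennreal_leI)
  moreover have "AE x in M. nn_cond_exp M F (\<lambda>x. ennreal (- g x)) x \<le> nn_cond_exp M F (\<lambda>x. ennreal (- f x)) x"
    by (rule nn_cond_exp_mono, use assms(1) in eventually_elim) (auto intro: ennreal_leI)
  ultimately show ?thesis
    by eventually_elim
       (auto simp: ext_cond_exp_def less_eq_ennreal.rep_eq intro!: ereal_minus_mono)
qed

section \<open>Functions bounded from below and finiteness of conditional expectations\<close>

lemma nn_cond_exp_add_const: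
  assumes [measurable]: "f \<in> borel_measurable M"
  shows "AE x in M. nn_cond_exp M F (\<lambda>x. f x + a) x = nn_cond_exp M F f x + a"
proof -
  have "AE x in M. a = nn_cond_exp M F (\<lambda>_. a) x" by (rule nn_cond_exp_F_meas) auto
  with nn_cond_exp_sum[of f "\<lambda>_. a"] show ?thesis by auto
qed

text \<open>Pointwise, the positive part of \<open>f\<close> plus \<open>c\<close> equals
  \<open>f + c\<close> plus the negative part of \<open>f\<close>. The negative part is at most
  \<open>c\<close>, so its conditional expectation is finite and can be subtracted.\<close>

lemma ext_cond_exp_add_const:
  assumes c: "0 \<le> c" and bound: "AE x in M. - c \<le> f x" and [measurable]: "f \<in> borel_measurable M"
  shows "AE x in M. ext_cond_exp M F f x + ereal c = enn2ereal (nn_cond_exp M F (\<lambda>x. ennreal (f x + c)) x)"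
proof -
  let ?E = "nn_cond_exp M F"
  have "AE x in M. ?E (\<lambda>x. ennreal (f x) + ennreal c) x = ?E (\<lambda>x. ennreal (f x + c) + ennreal (- f x)) x"
  proof (rule nn_cond_exp_cong)
    show "AE x in M. ennreal (f x) + ennreal c = ennreal (f x + c) + ennreal (- f x)"
      using bound
    proof eventually_elim
      case (elim x)
      show ?case
        by (cases "0 \<le> f x") (use elim c in \<open>auto simp flip: ennreal_plus simp: ennreal_neg\<close>)
    qed
  qed auto
  moreover have "AE x in M. ?E (\<lambda>x. ennreal (f x) + ennreal c) x = ?E (\<lambda>x. ennreal (f x)) x + ennreal c"
    by (rule nn_cond_exp_add_const) auto
  moreover have "AE x in M. ?E (\<lambda>x. ennreal (f x + c)) x + ?E (\<lambda>x. ennreal (- f x)) x =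
      ?E (\<lambda>x. ennreal (f x + c) + ennreal (- f x)) x"
    by (rule nn_cond_exp_sum) auto
  moreover have "AE x in M. ?E (\<lambda>x. ennreal (- f x)) x \<le> ?E (\<lambda>_. ennreal c) x"
    by (rule nn_cond_exp_mono, use bound in eventually_elim) (auto intro: ennreal_leI)
  moreover have "AE x in M. ennreal c = ?E (\<lambda>_. ennreal c) x"
    by (rule nn_cond_exp_F_meas) auto
  ultimately show ?thesis
  proof eventually_elim
    case (elim x)
    \<comment> \<open>Finiteness of the negative part lets \<open>q\<close> move across the
      equation; \<open>p\<close> and \<open>r\<close> may then still both be infinite, and the two
      sides agree as extended reals.\<close>
    have fin: "?E (\<lambda>x. ennreal (- f x)) x < \<top>"
      using elim(4,5) by (metis ennreal_less_top order_le_less_trans)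
    define p q r where "p = ?E (\<lambda>x. ennreal (f x)) x" and "q = ?E (\<lambda>x. ennreal (- f x)) x"
      and "r = ?E (\<lambda>x. ennreal (f x + c)) x"
    have eq: "p + ennreal c = r + q" using elim by (simp add: p_def q_def r_def)
    obtain q' where q': "q = ennreal q'" "0 \<le> q'" using fin unfolding q_def by (cases "?E (\<lambda>x. ennreal (- f x)) x") auto
    have "enn2ereal p - enn2ereal q + ereal c = enn2ereal r"
      using eq q' c
      by (cases p; cases r) (auto simp: enn2ereal_ennreal simp flip: ennreal_plus)
    then show ?case by (simp add: ext_cond_exp_def p_def q_def r_def)
  qed
qed

text \<open>Translates a bound on an extended conditional expectation into one in
  \<open>ennreal\<close>, where monotonicity and the tower property are available for infinite
  values as well. The conjunct \<open>0 \<le> y x + c\<close> is there because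
  \<open>ennreal\<close> sends negative reals to 0, so that the inequality alone would lose the
  sign.\<close>

lemma ext_cond_exp_le_iff:
  assumes c: "0 \<le> c" and bound: "AE x in M. - c \<le> f x" and [measurable]: "f \<in> borel_measurable M"
  shows "AE x in M. ext_cond_exp M F f x \<le> ereal (y x) \<longleftrightarrow>
    0 \<le> y x + c \<and> nn_cond_exp M F (\<lambda>x. ennreal (f x + c)) x \<le> ennreal (y x + c)"
  using ext_cond_exp_add_const[OF assms]
proof eventually_elim
  case (elim x)
  let ?r = "nn_cond_exp M F (\<lambda>x. ennreal (f x + c)) x"
  have "ext_cond_exp M F f x \<le> ereal (y x) \<longleftrightarrow> ext_cond_exp M F f x + ereal c \<le> ereal (y x + c)"
    by (cases "ext_cond_exp M F f x") auto
  also have "\<dots> \<longleftrightarrow> enn2ereal ?r \<le> ereal (y x + c)" by (simp only: elim)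
  also have "\<dots> \<longleftrightarrow> 0 \<le> y x + c \<and> ?r \<le> ennreal (y x + c)"
    using enn2ereal_nonneg[of ?r]
    by (cases "0 \<le> y x + c")
       (auto simp: less_eq_ennreal.rep_eq enn2ereal_ennreal simp del: enn2ereal_nonneg dest: order_trans)
  finally show ?case .
qed

lemma nn_cond_exp_abs_finite:
  assumes "integrable M f"
  shows "AE x in M. nn_cond_exp M F (\<lambda>x. ennreal \<bar>f x\<bar>) x < \<infinity>"
proof -
  have [measurable]: "f \<in> borel_measurable M" using assms by simp
  have "(\<integral>\<^sup>+x. nn_cond_exp M F (\<lambda>x. ennreal \<bar>f x\<bar>) x \<partial>M) = (\<integral>\<^sup>+x. ennreal \<bar>f x\<bar> \<partial>M)"
    using nn_cond_exp_intg[of "\<lambda>_. 1" "\<lambda>x. ennreal \<bar>f x\<bar>"] by simp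
  also have "\<dots> < \<infinity>" using assms by (simp add: integrable_iff_bounded)
  finally show ?thesis
    using nn_integral_PInf_AE[of "nn_cond_exp M F (\<lambda>x. ennreal \<bar>f x\<bar>)" M]
    by (auto simp: less_top)
qed

lemma ext_cond_exp_eq_real_cond_exp:
  assumes "AE x in M. nn_cond_exp M F (\<lambda>x. ennreal \<bar>f x\<bar>) x < \<infinity>" and [measurable]: "f \<in> borel_measurable M"
  shows "AE x in M. ext_cond_exp M F f x = ereal (real_cond_exp M F f x)"
proof -
  let ?E = "nn_cond_exp M F"
  have "AE x in M. ?E (\<lambda>x. ennreal (f x)) x \<le> ?E (\<lambda>x. ennreal \<bar>f x\<bar>) x"
    by (rule nn_cond_exp_mono) (auto intro: ennreal_leI)
  moreover have "AE x in M. ?E (\<lambda>x. ennreal (- f x)) x \<le> ?E (\<lambda>x. ennreal \<bar>f x\<bar>) x"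
    by (rule nn_cond_exp_mono) (auto intro: ennreal_leI)
  ultimately show ?thesis using assms(1)
  proof eventually_elim
    case (elim x)
    then have "?E (\<lambda>x. ennreal (f x)) x < \<top>" "?E (\<lambda>x. ennreal (- f x)) x < \<top>" by auto
    then show ?case
      by (cases "?E (\<lambda>x. ennreal (f x)) x"; cases "?E (\<lambda>x. ennreal (- f x)) x")
         (auto simp: ext_cond_exp_def real_cond_exp_def enn2ereal_ennreal)
  qed
qed

text \<open>If \<open>A\<close> is the set where \<open>f\<close> is infinite, the conditional
  expectation of \<open>f\<close> dominates infinity times that of the indicator of
  \<open>A\<close>. Finiteness forces the latter to vanish almost everywhere, so \<open>A\<close> is
  a null set.\<close>

lemma AE_finite_if_nn_cond_exp_finite:
  assumes fin: "AE x in M. nn_cond_exp M F f x < \<infinity>" and [measurable]: "f \<in> borel_measurable M"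
  shows "AE x in M. f x < \<infinity>"
proof -
  define A where "A = {x \<in> space M. f x = \<infinity>}"
  have [measurable]: "A \<in> sets M" unfolding A_def by measurable
  let ?E = "nn_cond_exp M F"
  have "AE x in M. ?E (\<lambda>x. \<infinity> * indicator A x) x \<le> ?E f x"
    by (rule nn_cond_exp_mono) (auto simp: A_def indicator_def)
  moreover have "AE x in M. \<infinity> * ?E (indicator A) x = ?E (\<lambda>x. \<infinity> * indicator A x) x"
    by (rule nn_cond_exp_prod) auto
  ultimately have zero: "AE x in M. ?E (indicator A) x = 0"
    using fin
  proof eventually_elim
    case (elim x)
    then have "\<infinity> * ?E (indicator A) x < \<infinity>" by (metis order_le_less_trans)
    then show ?case by (auto simp: ennreal_mult_less_top infinity_ennreal_def)
  qed
  have "emeasure M A = (\<integral>\<^sup>+x. ?E (indicator A) x \<partial>M)"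
    using nn_cond_exp_intg[of "\<lambda>_. 1" "indicator A"] by simp
  also have "\<dots> = (\<integral>\<^sup>+x. 0 \<partial>M)" by (rule nn_integral_cong_AE[OF zero])
  finally have "A \<in> null_sets M" by (auto intro: null_setsI)
  then have "AE x in M. x \<notin> A" by (rule AE_not_in)
  then show ?thesis using AE_space by eventually_elim (auto simp: A_def less_top)
qed

end

section \<open>Supermartingales\<close>

lemma supermartingaleD:
  assumes "supermartingale M F a b X"
  shows "t \<in> {a..b} \<Longrightarrow> X t \<in> borel_measurable (F t)"
    and "t \<in> {a..b} \<Longrightarrow> integrable M (X t)"
    and "s \<in> {a..b} \<Longrightarrow> t \<in> {s..b} \<Longrightarrow> AE \<omega> in M. real_cond_exp M (F s) (X t) \<omega> \<le> X s \<omega>"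
  using assms unfolding supermartingale_def by blast+

lemma generalized_supermartingaleD:
  assumes "generalized_supermartingale M F a b X"
  shows "t \<in> {a..b} \<Longrightarrow> X t \<in> borel_measurable (F t)"
    and "s \<in> {a..b} \<Longrightarrow> t \<in> {s..b} \<Longrightarrow> AE \<omega> in M. ext_cond_exp M (F s) (X t) \<omega> \<le> ereal (X s \<omega>)"
  using assms unfolding generalized_supermartingale_def by blast+

text \<open>Serves both measures: \<open>P\<close> and \<open>Q\<close> instantiate it with the same
  filtration, which is constrained only up to the horizon \<open>n\<close>.\<close>

locale filtered_finite_measure = finite_measure M for M :: "'a measure" +
  fixes F :: "nat \<Rightarrow> 'a measure" and n :: nat
  assumes subalgebra_F: "i \<le> n \<Longrightarrow> subalgebra M (F i)"
    and F_mono: "i \<le> j \<Longrightarrow> j \<le> n \<Longrightarrow> sets (F i) \<subseteq> sets (F j)"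
begin

lemma sigma_finite_F: "i \<le> n \<Longrightarrow> sigma_finite_subalgebra M (F i)"
  by (intro finite_measure_subalgebra_is_sigma_finite)
     (auto simp: finite_measure_subalgebra_def finite_measure_subalgebra_axioms_def subalgebra_F finite_measure_axioms)

lemma subalgebra_F_F: "i \<le> j \<Longrightarrow> j \<le> n \<Longrightarrow> subalgebra (F j) (F i)"
  using subalgebra_F[of i] subalgebra_F[of j] F_mono[of i j] by (auto simp: subalgebra_def)

lemma measurable_F_mono: "f \<in> borel_measurable (F i) \<Longrightarrow> i \<le> j \<Longrightarrow> j \<le> n \<Longrightarrow> f \<in> borel_measurable (F j)"
  using measurable_from_subalg[OF subalgebra_F_F] by blast

lemma measurable_F: "f \<in> borel_measurable (F i) \<Longrightarrow> i \<le> n \<Longrightarrow> f \<in> borel_measurable M"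
  using measurable_from_subalg[OF subalgebra_F] by blast

section \<open>Gluing, extending and shifting supermartingales\<close>

text \<open>The event \<open>A\<close> is known at the initial time and so lies in every later
  sigma-algebra. Locality of conditional expectation then reduces the inequality to that of
  \<open>X\<close> on \<open>A\<close> and to that of \<open>Y\<close> off \<open>A\<close>.\<close>

lemma supermartingale_If:
  assumes X: "supermartingale M F a n X" and Y: "supermartingale M F a n Y"
    and A: "A \<in> sets (F a)" and "a \<le> n"
  shows "supermartingale M F a n (\<lambda>t \<omega>. if \<omega> \<in> A then X t \<omega> else Y t \<omega>)"
  unfolding supermartingale_def
proof (intro conjI ballI)
  fix t assume t: "t \<in> {a..n}"
  have A_t[measurable]: "A \<in> sets (F t)" "A \<in> sets M"
    using A t F_mono[of a t] subalgebra_F[of t] by (auto simp: subalgebra_def)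
  have [measurable]: "X t \<in> borel_measurable (F t)" "Y t \<in> borel_measurable (F t)"
    and int: "integrable M (X t)" "integrable M (Y t)"
    using X Y t by (auto simp: supermartingale_def)
  show "(\<lambda>\<omega>. if \<omega> \<in> A then X t \<omega> else Y t \<omega>) \<in> borel_measurable (F t)" by measurable
  have [measurable]: "X t \<in> borel_measurable M" "Y t \<in> borel_measurable M" using int by auto
  show "integrable M (\<lambda>\<omega>. if \<omega> \<in> A then X t \<omega> else Y t \<omega>)"
    by (rule Bochner_Integration.integrable_bound[where f = "\<lambda>\<omega>. \<bar>X t \<omega>\<bar> + \<bar>Y t \<omega>\<bar>"]) (use int in auto)
next
  fix s t assume s: "s \<in> {a..n}" and t: "t \<in> {s..n}"
  interpret s: sigma_finite_subalgebra M "F s" using s by (intro sigma_finite_F) auto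
  have A_s: "A \<in> sets (F s)" using A s F_mono[of a s] by auto
  have "X t \<in> borel_measurable M" "Y t \<in> borel_measurable M"
    using supermartingaleD(2)[OF X, of t] supermartingaleD(2)[OF Y, of t] s t by auto
  from s.real_cond_exp_If[OF A_s this] supermartingaleD(3)[OF X s t] supermartingaleD(3)[OF Y s t]
  show "AE \<omega> in M. real_cond_exp M (F s) (\<lambda>\<omega>. if \<omega> \<in> A then X t \<omega> else Y t \<omega>) \<omega>
      \<le> (if \<omega> \<in> A then X s \<omega> else Y s \<omega>)"
    by eventually_elim auto
qed

text \<open>Prepends the value \<open>Z\<close> at time \<open>a\<close> to a process that starts at
  \<open>Suc a\<close>. The new inequalities are those with \<open>s = a\<close>: for later
  \<open>t\<close> they are \<open>le\<close>, and for \<open>t = a\<close> they hold because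
  \<open>Z\<close> is \<open>F a\<close>-measurable.\<close>

lemma supermartingale_fun_upd:
  assumes X: "supermartingale M F (Suc a) n X" and "a \<le> n"
    and Z: "Z \<in> borel_measurable (F a)" "integrable M Z"
    and le: "\<And>t. t \<in> {Suc a..n} \<Longrightarrow> AE \<omega> in M. real_cond_exp M (F a) (X t) \<omega> \<le> Z \<omega>"
  shows "supermartingale M F a n (X(a := Z))"
  unfolding supermartingale_def
proof (intro conjI ballI)
  fix t assume "t \<in> {a..n}"
  then show "(X(a := Z)) t \<in> borel_measurable (F t)" "integrable M ((X(a := Z)) t)"
    using X Z by (auto simp: supermartingale_def)
next
  fix s t assume s: "s \<in> {a..n}" and t: "t \<in> {s..n}"
  interpret a: sigma_finite_subalgebra M "F a" using \<open>a \<le> n\<close> by (rule sigma_finite_F)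
  show "AE \<omega> in M. real_cond_exp M (F s) ((X(a := Z)) t) \<omega> \<le> (X(a := Z)) s \<omega>"
  proof (cases "s = a")
    case True
    show ?thesis
    proof (cases "t = a")
      case True
      from a.real_cond_exp_F_meas[OF Z(2,1)] show ?thesis
        by eventually_elim (simp add: \<open>s = a\<close> \<open>t = a\<close>)
    next
      case False
      with \<open>s = a\<close> t have "AE \<omega> in M. real_cond_exp M (F a) (X t) \<omega> \<le> Z \<omega>" by (intro le) auto
      then show ?thesis by eventually_elim (simp add: \<open>s = a\<close> \<open>t \<noteq> a\<close>)
    qed
  next
    case False
    with s t have "s \<in> {Suc a..n}" "t \<in> {s..n}" "t \<noteq> a" by auto
    with X False show ?thesis by (simp add: supermartingale_def)
  qed
qed

lemma supermartingale_add:
  assumes X: "supermartingale M F a n X" and D: "D \<in> borel_measurable (F a)" "integrable M D"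
  shows "supermartingale M F a n (\<lambda>t \<omega>. X t \<omega> + D \<omega>)"
  unfolding supermartingale_def
proof (intro conjI ballI)
  fix t assume t: "t \<in> {a..n}"
  have [measurable]: "X t \<in> borel_measurable (F t)" "D \<in> borel_measurable (F t)"
    using supermartingaleD(1)[OF X t] measurable_F_mono[OF D(1), of t] t by auto
  show "(\<lambda>\<omega>. X t \<omega> + D \<omega>) \<in> borel_measurable (F t)" by measurable
  show "integrable M (\<lambda>\<omega>. X t \<omega> + D \<omega>)"
    using supermartingaleD(2)[OF X t] D(2) by simp
next
  fix s t assume s: "s \<in> {a..n}" and t: "t \<in> {s..n}"
  interpret s: sigma_finite_subalgebra M "F s" using s by (intro sigma_finite_F) auto
  have int: "integrable M (X t)" using supermartingaleD(2)[OF X, of t] s t by auto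
  have "D \<in> borel_measurable (F s)" using measurable_F_mono[OF D(1), of s] s by auto
  from s.real_cond_exp_F_meas[OF D(2) this] supermartingaleD(3)[OF X s t] s.real_cond_exp_add[OF int D(2)]
  show "AE \<omega> in M. real_cond_exp M (F s) (\<lambda>\<omega>. X t \<omega> + D \<omega>) \<omega> \<le> X s \<omega> + D \<omega>"
    by eventually_elim simp
qed

section \<open>Processes bounded from below\<close>

text \<open>Since \<open>\<bar>X t\<bar> \<le> (X t + c) + c\<close>, the inequality for the shifted
  process in \<open>ennreal\<close> already bounds the conditional expectation of the absolute value
  by a finite quantity.\<close>

lemma generalized_supermartingale_lower_boundedI:
  assumes "b \<le> n" "0 \<le> c"
    and X: "\<And>t. t \<in> {a..b} \<Longrightarrow> X t \<in> borel_measurable (F t)"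
    and bound: "\<And>t. t \<in> {a..b} \<Longrightarrow> AE \<omega> in M. - c \<le> X t \<omega>"
    and le: "\<And>s t. s \<in> {a..b} \<Longrightarrow> t \<in> {s..b} \<Longrightarrow>
      AE \<omega> in M. nn_cond_exp M (F s) (\<lambda>\<omega>. ennreal (X t \<omega> + c)) \<omega> \<le> ennreal (X s \<omega> + c)"
  shows "generalized_supermartingale M F a b X"
  unfolding generalized_supermartingale_def
proof (intro conjI ballI)
  fix s t assume s: "s \<in> {a..b}" and t: "t \<in> {s..b}"
  interpret s: sigma_finite_subalgebra M "F s" using s \<open>b \<le> n\<close> by (intro sigma_finite_F) auto
  have [measurable]: "X t \<in> borel_measurable M" by (rule measurable_F[OF X]) (use s t \<open>b \<le> n\<close> in auto)
  have bound': "AE \<omega> in M. - c \<le> X t \<omega>" "AE \<omega> in M. - c \<le> X s \<omega>" by (rule bound; use s t in auto)+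
  have "AE \<omega> in M. nn_cond_exp M (F s) (\<lambda>\<omega>. ennreal \<bar>X t \<omega>\<bar>) \<omega>
      \<le> nn_cond_exp M (F s) (\<lambda>\<omega>. ennreal (X t \<omega> + c) + ennreal c) \<omega>"
  proof (rule s.nn_cond_exp_mono)
    show "AE \<omega> in M. ennreal \<bar>X t \<omega>\<bar> \<le> ennreal (X t \<omega> + c) + ennreal c"
      using bound'(1)
    proof eventually_elim
      case (elim \<omega>)
      then have "ennreal \<bar>X t \<omega>\<bar> \<le> ennreal ((X t \<omega> + c) + c)"
        using \<open>0 \<le> c\<close> by (intro ennreal_leI) auto
      also have "\<dots> = ennreal (X t \<omega> + c) + ennreal c"
        using elim \<open>0 \<le> c\<close> by (intro ennreal_plus) auto
      finally show ?case .
    qed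
  qed auto
  moreover have "AE \<omega> in M. nn_cond_exp M (F s) (\<lambda>\<omega>. ennreal (X t \<omega> + c) + ennreal c) \<omega>
      = nn_cond_exp M (F s) (\<lambda>\<omega>. ennreal (X t \<omega> + c)) \<omega> + ennreal c"
    by (rule s.nn_cond_exp_add_const) auto
  ultimately show "AE \<omega> in M. nn_cond_exp M (F s) (\<lambda>\<omega>. ennreal \<bar>X t \<omega>\<bar>) \<omega> < \<infinity>"
    using le[OF s t]
  proof eventually_elim
    case (elim \<omega>)
    have "nn_cond_exp M (F s) (\<lambda>\<omega>. ennreal \<bar>X t \<omega>\<bar>) \<omega> \<le> ennreal (X s \<omega> + c) + ennreal c"
      using elim(1) unfolding elim(2) by (rule order_trans) (intro add_right_mono elim(3))
    also have "\<dots> < \<infinity>" by simp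
    finally show ?case .
  qed
  show "AE \<omega> in M. ext_cond_exp M (F s) (X t) \<omega> \<le> ereal (X s \<omega>)"
    using s.ext_cond_exp_le_iff[OF \<open>0 \<le> c\<close> bound'(1) \<open>X t \<in> borel_measurable M\<close>, of "X s"]
      le[OF s t] bound'(2)
    by eventually_elim simp
qed (rule X)

text \<open>Integrability propagates from the initial time: integrating \<open>le\<close> with
  \<open>s = a\<close> bounds the mean of \<open>X t + c\<close> by that of \<open>X a + c\<close>.
  Extended and real conditional expectations then coincide.\<close>

lemma supermartingale_lower_boundedI:
  assumes "a \<le> b" "b \<le> n" "0 \<le> c"
    and X: "\<And>t. t \<in> {a..b} \<Longrightarrow> X t \<in> borel_measurable (F t)"
    and bound: "\<And>t. t \<in> {a..b} \<Longrightarrow> AE \<omega> in M. - c \<le> X t \<omega>"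
    and le: "\<And>s t. s \<in> {a..b} \<Longrightarrow> t \<in> {s..b} \<Longrightarrow>
      AE \<omega> in M. nn_cond_exp M (F s) (\<lambda>\<omega>. ennreal (X t \<omega> + c)) \<omega> \<le> ennreal (X s \<omega> + c)"
    and int: "integrable M (X a)"
  shows "supermartingale M F a b X"
proof -
  have gen: "generalized_supermartingale M F a b X"
    by (rule generalized_supermartingale_lower_boundedI[OF \<open>b \<le> n\<close> \<open>0 \<le> c\<close> X bound le])
  have int_X: "integrable M (X t)" if t: "t \<in> {a..b}" for t
  proof -
    interpret a: sigma_finite_subalgebra M "F a" using \<open>a \<le> b\<close> \<open>b \<le> n\<close> by (intro sigma_finite_F) auto
    have [measurable]: "X t \<in> borel_measurable M" by (rule measurable_F[OF X]) (use t \<open>b \<le> n\<close> in auto)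
    have "(\<integral>\<^sup>+\<omega>. ennreal (X t \<omega> + c) \<partial>M) = (\<integral>\<^sup>+\<omega>. nn_cond_exp M (F a) (\<lambda>\<omega>. ennreal (X t \<omega> + c)) \<omega> \<partial>M)"
      using a.nn_cond_exp_intg[of "\<lambda>_. 1" "\<lambda>\<omega>. ennreal (X t \<omega> + c)"] by simp
    also have "\<dots> \<le> (\<integral>\<^sup>+\<omega>. ennreal (X a \<omega> + c) \<partial>M)"
      using le[of a t] t \<open>a \<le> b\<close> by (intro nn_integral_mono_AE) auto
    also have "\<dots> \<le> (\<integral>\<^sup>+\<omega>. ennreal \<bar>X a \<omega> + c\<bar> \<partial>M)"
      by (intro nn_integral_mono ennreal_leI) auto
    also have "\<dots> < \<infinity>"
      using Bochner_Integration.integrable_add[OF int integrable_const[of c]] by (simp only: integrable_iff_bounded real_norm_def)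
    finally have "(\<integral>\<^sup>+\<omega>. ennreal (X t \<omega> + c) \<partial>M) < \<infinity>" .
    then have "integrable M (\<lambda>\<omega>. X t \<omega> + c)"
      using bound[OF t] by (intro integrableI_nonneg) auto
    from Bochner_Integration.integrable_diff[OF this, of "\<lambda>_. c"] show ?thesis by simp
  qed
  show ?thesis
    unfolding supermartingale_def
  proof (intro conjI ballI)
    fix s t assume s: "s \<in> {a..b}" and t: "t \<in> {s..b}"
    interpret s: sigma_finite_subalgebra M "F s" using s \<open>b \<le> n\<close> by (intro sigma_finite_F) auto
    have "AE \<omega> in M. ext_cond_exp M (F s) (X t) \<omega> = ereal (real_cond_exp M (F s) (X t) \<omega>)"
      using int_X[of t] s t by (intro s.ext_cond_exp_eq_real_cond_exp s.nn_cond_exp_abs_finite) auto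
    moreover have "AE \<omega> in M. ext_cond_exp M (F s) (X t) \<omega> \<le> ereal (X s \<omega>)"
      by (rule generalized_supermartingaleD(2)[OF gen s t])
    ultimately show "AE \<omega> in M. real_cond_exp M (F s) (X t) \<omega> \<le> X s \<omega>"
      by eventually_elim simp
  qed (fact X int_X)+
qed

lemma supermartingale_imp_generalized:
  assumes "b \<le> n" and X: "supermartingale M F a b X"
  shows "generalized_supermartingale M F a b X"
  unfolding generalized_supermartingale_def
proof (intro conjI ballI)
  fix s t assume s: "s \<in> {a..b}" and t: "t \<in> {s..b}"
  interpret s: sigma_finite_subalgebra M "F s" using s \<open>b \<le> n\<close> by (intro sigma_finite_F) auto
  have int: "integrable M (X t)" using supermartingaleD(2)[OF X, of t] s t by auto
  show fin: "AE \<omega> in M. nn_cond_exp M (F s) (\<lambda>\<omega>. ennreal \<bar>X t \<omega>\<bar>) \<omega> < \<infinity>"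
    by (rule s.nn_cond_exp_abs_finite[OF int])
  from supermartingaleD(3)[OF X s t]
  show "AE \<omega> in M. ext_cond_exp M (F s) (X t) \<omega> \<le> ereal (X s \<omega>)"
    using s.ext_cond_exp_eq_real_cond_exp[OF fin borel_measurable_integrable[OF int]]
    by eventually_elim simp
qed (rule supermartingaleD(1)[OF X])

end

section \<open>Approximation of essential infima in the mean\<close>

context finite_measure
begin

text \<open>The positive excess of \<open>V\<close> over \<open>g\<close>, cut off at 1, is at most
  \<open>R - g\<close>, whose integral is at most \<open>e\<close>. As \<open>e\<close> is
  arbitrary, the excess has integral zero and vanishes almost everywhere.\<close>

lemma AE_le_if_integral_approx:
  fixes V :: "'a \<Rightarrow> ereal" and g :: "'a \<Rightarrow> real"
  assumes [measurable]: "V \<in> borel_measurable M" and g: "integrable M g"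
    and approx: "\<And>e. 0 < e \<Longrightarrow> \<exists>R. integrable M R \<and> (AE x in M. V x \<le> ereal (R x)) \<and>
      (AE x in M. g x \<le> R x) \<and> (\<integral>x. R x \<partial>M) \<le> (\<integral>x. g x \<partial>M) + e"
  shows "AE x in M. V x \<le> ereal (g x)"
proof -
  have [measurable]: "g \<in> borel_measurable M" using g by simp
  \<comment> \<open>The cut-off at 1 makes \<open>U\<close> bounded, hence integrable, even where
    \<open>V\<close> is infinite. The argument of \<open>real_of_ereal\<close> lies between 0 and 1,
    so its default value at infinite arguments never occurs.\<close>
  define U where "U x = real_of_ereal (max 0 (min 1 (V x - ereal (g x))))" for x
  have U_real: "U x = max 0 (min 1 (v - g x))" if "V x = ereal v" for x v
    unfolding U_def that one_ereal_def zero_ereal_def by (simp flip: ereal_min ereal_max)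
  have U_PInf: "U x = 1" if "V x = \<infinity>" for x
    unfolding U_def that by (simp add: min_def)
  have U_MInf: "U x = 0" if "V x = - \<infinity>" for x
    unfolding U_def that by (simp add: min_def max_def)
  have U: "0 \<le> U x" "U x \<le> 1" for x
    by (cases "V x"; simp add: U_real U_PInf U_MInf)+
  have [measurable]: "U \<in> borel_measurable M" unfolding U_def[abs_def] by measurable
  have int_U: "integrable M U"
    by (rule integrable_const_bound[of _ 1]) (use U in auto)
  have "(\<integral>x. U x \<partial>M) \<le> e" if "0 < e" for e
  proof -
    obtain R where R: "integrable M R" "AE x in M. V x \<le> ereal (R x)" "AE x in M. g x \<le> R x"
        "(\<integral>x. R x \<partial>M) \<le> (\<integral>x. g x \<partial>M) + e"
      using approx[OF \<open>0 < e\<close>] by blast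
    have "(\<integral>x. U x \<partial>M) \<le> (\<integral>x. R x - g x \<partial>M)"
    proof (rule integral_mono_AE[OF int_U])
      show "AE x in M. U x \<le> R x - g x"
        using R(2,3)
      proof eventually_elim
        case (elim x)
        then show ?case by (cases "V x") (auto simp: U_real U_PInf U_MInf)
      qed
    qed (simp add: R(1) g)
    also have "\<dots> \<le> e" using R(4) by (simp add: R(1) g)
    finally show ?thesis .
  qed
  then have "(\<integral>x. U x \<partial>M) \<le> 0" by (rule field_le_epsilon) simp
  moreover have "0 \<le> (\<integral>x. U x \<partial>M)" by (rule Bochner_Integration.integral_nonneg) (rule U)
  ultimately have "(\<integral>x. U x \<partial>M) = 0" by simp
  then have "AE x in M. U x = 0"
    using integral_nonneg_eq_0_iff_AE[OF int_U] U by simp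
  then show ?thesis
  proof eventually_elim
    case (elim x)
    then show ?case
      by (cases "V x") (auto simp: U_real U_PInf U_MInf max_def min_def split: if_splits)
  qed
qed

text \<open>Take a sequence minimizing the mean of \<open>max X g\<close>. Its running minima, each
  joined with \<open>g\<close>, decrease to a limit \<open>Y\<close>, and minimality gives
  \<open>Y \<le> max Z g\<close> almost everywhere for every \<open>Z\<close> in
  \<open>\<Phi>\<close>. Restricted to the set where \<open>Y > g\<close>, \<open>Y\<close> is a
  lower bound of \<open>\<Phi>\<close>, so by \<open>lower\<close> this set is null. Dominated
  convergence then brings the means down to that of \<open>g\<close>.\<close>

lemma integral_max_approx:
  fixes \<Phi> :: "('a \<Rightarrow> real) set" and g :: "'a \<Rightarrow> real"
  assumes ne: "\<Phi> \<noteq> {}" and int: "\<And>X. X \<in> \<Phi> \<Longrightarrow> integrable M X"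
    and min: "\<And>X Y. X \<in> \<Phi> \<Longrightarrow> Y \<in> \<Phi> \<Longrightarrow> (\<lambda>x. min (X x) (Y x)) \<in> \<Phi>"
    and g: "integrable M g"
    and lower: "\<And>Z. Z \<in> borel_measurable M \<Longrightarrow> (\<And>X. X \<in> \<Phi> \<Longrightarrow> AE x in M. Z x \<le> ereal (X x)) \<Longrightarrow>
      AE x in M. Z x \<le> ereal (g x)"
    and "0 < e"
  shows "\<exists>X\<in>\<Phi>. (\<integral>x. max (X x) (g x) \<partial>M) < (\<integral>x. g x \<partial>M) + e"
proof -
  define h where "h X = (\<integral>x. max (X x) (g x) \<partial>M)" for X
  define J where "J = Inf (h ` \<Phi>)"
  have [measurable]: "g \<in> borel_measurable M" using g by simp
  have int_max: "integrable M (\<lambda>x. max (X x) (g x))" if "X \<in> \<Phi>" for X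
    using int[OF that] g by (rule integrable_max)
  have bdd: "bdd_below (h ` \<Phi>)"
    by (rule bdd_belowI2[of _ "\<integral>x. g x \<partial>M"])
       (auto simp: h_def intro!: integral_mono g int_max)
  have J_le: "J \<le> h X" if "X \<in> \<Phi>" for X
    unfolding J_def by (rule cINF_lower[OF bdd that])
  have "\<exists>X\<in>\<Phi>. h X < J + 1 / real (Suc j)" for j
    using cINF_less_iff[OF ne bdd, of "J + 1 / real (Suc j)"] by (simp add: J_def)
  then obtain X where X: "\<And>j. X j \<in> \<Phi>" "\<And>j. h (X j) < J + 1 / real (Suc j)" by metis
  \<comment> \<open>Running minima of the minimizing sequence. Each is a minimum of finitely many
    members and therefore stays in \<open>\<Phi>\<close>, whereas the limit may leave it.\<close>
  define m where "m = rec_nat (X 0) (\<lambda>j Y x. min (Y x) (X (Suc j) x))"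
  have m_Suc: "m (Suc j) = (\<lambda>x. min (m j x) (X (Suc j) x))" for j by (simp add: m_def)
  have m_\<Phi>: "m j \<in> \<Phi>" for j
    by (induction j) (auto simp: m_Suc X min, auto simp: m_def X)
  have m_le: "m j x \<le> X j x" for j x
    by (cases j) (auto simp: m_Suc, auto simp: m_def)
  have h_m: "h (m j) < J + 1 / real (Suc j)" for j
  proof -
    have "h (m j) \<le> h (X j)"
      unfolding h_def by (intro integral_mono int_max m_\<Phi> X max.mono m_le order_refl)
    with X(2)[of j] show ?thesis by linarith
  qed
  have dec: "decseq (\<lambda>j. max (m j x) (g x))" for x
    by (intro decseq_SucI max.mono) (auto simp: m_Suc)
  have bdd': "bdd_below (range (\<lambda>j. max (m j x) (g x)))" for x
    by (rule bdd_belowI2[of _ "g x"]) auto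
  define Y where "Y x = (INF j. max (m j x) (g x))" for x
  have lim: "(\<lambda>j. max (m j x) (g x)) \<longlonglongrightarrow> Y x" for x
    unfolding Y_def by (rule LIMSEQ_decseq_INF[OF bdd' dec])
  have Y_le: "Y x \<le> max (m j x) (g x)" for j x
    unfolding Y_def by (intro cINF_lower bdd') auto
  have g_le: "g x \<le> Y x" for x
    unfolding Y_def by (rule cINF_greatest) auto
  have m_meas[measurable]: "m j \<in> borel_measurable M" for j using int[OF m_\<Phi>] by simp
  have Y_meas[measurable]: "Y \<in> borel_measurable M"
    by (rule borel_measurable_LIMSEQ_real[OF lim]) auto
  have m_0: "max (m j x) (g x) \<le> max (m 0 x) (g x)" for j x
    using dec[of x] by (simp add: decseq_def)
  have int_lim: "(\<lambda>j. h (m j)) \<longlonglongrightarrow> (\<integral>x. Y x \<partial>M)"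
    unfolding h_def
  proof (rule integral_dominated_convergence[where w = "\<lambda>x. \<bar>max (m 0 x) (g x)\<bar> + \<bar>g x\<bar>"])
    show "integrable M (\<lambda>x. \<bar>max (m 0 x) (g x)\<bar> + \<bar>g x\<bar>)"
      using int_max[OF m_\<Phi>[of 0]] g by auto
    show "AE x in M. norm (max (m j x) (g x)) \<le> \<bar>max (m 0 x) (g x)\<bar> + \<bar>g x\<bar>" for j
    proof (rule AE_I2)
      fix x show "norm (max (m j x) (g x)) \<le> \<bar>max (m 0 x) (g x)\<bar> + \<bar>g x\<bar>"
        using m_0[of j x] max.cobounded2[of "g x" "m j x"] unfolding real_norm_def by linarith
    qed
  qed (use lim in auto)
  have Y_le_max: "AE x in M. ereal (Y x) \<le> ereal (max (Z x) (g x))" if Z: "Z \<in> \<Phi>" for Z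
  proof (rule AE_le_if_integral_approx[OF _ int_max[OF Z]])
    fix d :: real assume "0 < d"
    then obtain j where j: "1 / real (Suc j) < d"
      using reals_Archimedean by (auto simp: inverse_eq_divide)
    define R where "R x = max (max (m j x) (Z x)) (g x)" for x
    \<comment> \<open>Modularity of maximum and minimum. In mean, the last term is at least
      \<open>J\<close> and the first is below \<open>J + 1 / real (Suc j)\<close>, so
      \<open>R\<close> exceeds \<open>max Z g\<close> by less than \<open>d\<close>.\<close>
    have eq: "R x = max (m j x) (g x) + max (Z x) (g x) - max (min (m j x) (Z x)) (g x)" for x
      by (auto simp: R_def max_def min_def)
    have int': "integrable M (\<lambda>x. max (m j x) (g x))" "integrable M (\<lambda>x. max (Z x) (g x))"
        "integrable M (\<lambda>x. max (min (m j x) (Z x)) (g x))"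
      using int_max[OF m_\<Phi>] int_max[OF Z] int_max[OF min[OF m_\<Phi> Z]] by auto
    then have int_R: "integrable M R" by (simp add: eq[abs_def])
    have "(\<integral>x. R x \<partial>M) = h (m j) + h Z - h (\<lambda>x. min (m j x) (Z x))"
      unfolding h_def eq using int' by simp
    also have "\<dots> \<le> h Z + d"
      using h_m[of j] J_le[OF min[OF m_\<Phi> Z], of j] j by linarith
    finally have "(\<integral>x. R x \<partial>M) \<le> (\<integral>x. max (Z x) (g x) \<partial>M) + d" by (simp add: h_def)
    moreover have "Y x \<le> R x" "max (Z x) (g x) \<le> R x" for x
      using Y_le[of x j] by (auto simp: R_def max_def split: if_splits)
    ultimately show "\<exists>R. integrable M R \<and> (AE x in M. ereal (Y x) \<le> ereal (R x)) \<and>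
        (AE x in M. max (Z x) (g x) \<le> R x) \<and> (\<integral>x. R x \<partial>M) \<le> (\<integral>x. max (Z x) (g x) \<partial>M) + d"
      using int_R by (intro exI[of _ R]) simp
  qed auto
  \<comment> \<open>Where \<open>Y > g\<close>, the bound by \<open>max Z g\<close> gives
    \<open>Y \<le> Z\<close>; elsewhere the value \<open>-\<infinity>\<close> is trivially a lower
    bound. Together they form a test function for \<open>lower\<close>.\<close>
  have "AE x in M. (if Y x \<le> g x then - \<infinity> else ereal (Y x)) \<le> ereal (g x)"
  proof (rule lower)
    fix Z assume "Z \<in> \<Phi>"
    from Y_le_max[OF this] show "AE x in M. (if Y x \<le> g x then - \<infinity> else ereal (Y x)) \<le> ereal (Z x)"
      by eventually_elim (auto simp: max_def split: if_splits)
  qed auto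
  then have "AE x in M. Y x = g x"
  proof eventually_elim
    case (elim x)
    then show ?case using g_le[of x] by (auto split: if_splits)
  qed
  then have "(\<integral>x. Y x \<partial>M) = (\<integral>x. g x \<partial>M)" by (intro integral_cong_AE) auto
  with int_lim \<open>0 < e\<close> have "\<forall>\<^sub>F j in sequentially. h (m j) < (\<integral>x. g x \<partial>M) + e"
    by (intro order_tendstoD(2)) auto
  then obtain j where "h (m j) < (\<integral>x. g x \<partial>M) + e" by (auto simp: eventually_sequentially)
  with m_\<Phi>[of j] show ?thesis unfolding h_def by blast
qed

end

section \<open>The one-step problem\<close>

text \<open>Equivalence of the measures is encoded by common measurable sets and common almost sure
  statements, without a density. The constant \<open>c\<close> makes \<open>l + c\<close>
  nonnegative, so that shifted losses embed into \<open>ennreal\<close>.\<close>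

locale equivalent_filtered_measures =
  P: prob_space P + P: filtered_finite_measure P F n + Q: filtered_finite_measure Q F n
  for P Q :: "'a measure" and F n +
  fixes S :: "nat \<Rightarrow> 'a \<Rightarrow> real" and l :: "real \<Rightarrow> real" and c :: real
  assumes sets_Q: "sets Q = sets P"
    and AE_Q: "\<And>R. (AE \<omega> in Q. R \<omega>) \<longleftrightarrow> (AE \<omega> in P. R \<omega>)"
    and S: "\<And>i. i \<le> n \<Longrightarrow> S i \<in> borel_measurable (F i)"
    and antimono_l: "antimono l"
    and c: "0 \<le> c" "\<And>x. - c \<le> l x"
begin

abbreviation "adm \<equiv> admissible_values P Q F S l n"

lemma measurable_Q: "borel_measurable Q = borel_measurable P"
  by (rule measurable_cong_sets[OF sets_Q refl])

lemma measurable_l [measurable]: "l \<in> borel_measurable borel"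
proof -
  have "(\<lambda>x. - l x) \<in> borel_measurable borel"
    using antimono_l by (intro borel_measurable_mono) (auto simp: mono_def antimono_def)
  then show ?thesis by simp
qed

lemma measurable_loss:
  assumes "X \<in> borel_measurable (F i)" "i \<le> n"
  shows "(\<lambda>\<omega>. l (X \<omega> - S i \<omega>)) \<in> borel_measurable (F i)"
proof -
  note [measurable] = assms(1) S[OF assms(2)]
  show ?thesis by measurable
qed

section \<open>Admissible initial values\<close>

lemma adm_I:
  assumes "supermartingale Q F k n M" "k \<le> n"
    and "\<And>t. t \<in> {k + 1..n} \<Longrightarrow> AE \<omega> in P. ext_cond_exp P (F k) (\<lambda>\<omega>. l (M t \<omega> - S t \<omega>)) \<omega> \<le> ereal (N t \<omega>)"
  shows "M k \<in> adm k N"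
proof -
  have "M k \<in> borel_measurable (F k)" by (rule supermartingaleD(1)[OF assms(1)]) (use assms(2) in auto)
  then show ?thesis unfolding admissible_values_def using assms(1,3) by blast
qed

lemma adm_E:
  assumes "X \<in> adm k N"
  obtains M where "M k = X" "supermartingale Q F k n M"
    "\<And>t. t \<in> {k + 1..n} \<Longrightarrow> AE \<omega> in P. ext_cond_exp P (F k) (\<lambda>\<omega>. l (M t \<omega> - S t \<omega>)) \<omega> \<le> ereal (N t \<omega>)"
  using assms unfolding admissible_values_def by blast

lemma adm_measurable: "k \<le> n \<Longrightarrow> X \<in> adm k N \<Longrightarrow> X \<in> borel_measurable P"
  unfolding admissible_values_def using P.measurable_F by blast

lemma adm_integrable:
  assumes "k \<le> n" "X \<in> adm k N"
  shows "integrable Q X"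
proof -
  obtain M where "M k = X" "supermartingale Q F k n M" using adm_E[OF assms(2)] by metis
  with supermartingaleD(2)[OF this(2), of k] assms(1) show ?thesis by auto
qed

lemma is_ess_inf_value_function:
  assumes "k < n"
  shows "is_ess_inf P (adm k N) (value_function P Q F S l n k N)"
  using P.is_ess_inf_ess_inf[of "adm k N"] adm_measurable[of k _ N] assms
  by (auto simp: value_function_def)

text \<open>The loss constraints concern times after \<open>k\<close> only, and raising the initial
  value preserves the supermartingale inequalities. It is enough to replace the value at time
  \<open>k\<close>.\<close>

lemma adm_mono:
  assumes X: "X \<in> adm k N" and "k \<le> n" and Z: "Z \<in> borel_measurable (F k)" "integrable Q Z"
    and le: "AE \<omega> in P. X \<omega> \<le> Z \<omega>"
  shows "Z \<in> adm k N"
proof -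
  obtain M where M: "M k = X" "supermartingale Q F k n M"
    "\<And>t. t \<in> {k + 1..n} \<Longrightarrow> AE \<omega> in P. ext_cond_exp P (F k) (\<lambda>\<omega>. l (M t \<omega> - S t \<omega>)) \<omega> \<le> ereal (N t \<omega>)"
    using adm_E[OF X] by metis
  have "supermartingale Q F k n (M(k := Z))"
  proof (rule Q.supermartingale_fun_upd[OF _ \<open>k \<le> n\<close> Z])
    show "supermartingale Q F (Suc k) n M"
      using M(2) unfolding supermartingale_def by auto
    fix t assume "t \<in> {Suc k..n}"
    then have "AE \<omega> in Q. real_cond_exp Q (F k) (M t) \<omega> \<le> M k \<omega>"
      by (intro supermartingaleD(3)[OF M(2)]) auto
    then show "AE \<omega> in Q. real_cond_exp Q (F k) (M t) \<omega> \<le> Z \<omega>"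
      using le unfolding AE_Q M(1) by eventually_elim simp
  qed
  from adm_I[OF this \<open>k \<le> n\<close>, of N] M(3) show ?thesis by simp
qed

text \<open>Follow the supermartingale started at \<open>X\<close> on the event where
  \<open>X \<le> Y\<close>, and the one started at \<open>Y\<close> off it. The event lies in
  \<open>F k\<close>, so the supermartingale property and the conditional loss bounds are inherited
  piecewise.\<close>

lemma adm_min:
  assumes X: "X \<in> adm k N" and Y: "Y \<in> adm k N" and "k \<le> n"
  shows "(\<lambda>\<omega>. min (X \<omega>) (Y \<omega>)) \<in> adm k N"
proof -
  interpret k: sigma_finite_subalgebra P "F k" using \<open>k \<le> n\<close> by (rule P.sigma_finite_F)
  have [measurable]: "X \<in> borel_measurable (F k)" "Y \<in> borel_measurable (F k)"
    using X Y by (auto simp: admissible_values_def)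
  obtain M1 where M1: "M1 k = X" "supermartingale Q F k n M1"
    "\<And>t. t \<in> {k + 1..n} \<Longrightarrow> AE \<omega> in P. ext_cond_exp P (F k) (\<lambda>\<omega>. l (M1 t \<omega> - S t \<omega>)) \<omega> \<le> ereal (N t \<omega>)"
    using adm_E[OF X] by metis
  obtain M2 where M2: "M2 k = Y" "supermartingale Q F k n M2"
    "\<And>t. t \<in> {k + 1..n} \<Longrightarrow> AE \<omega> in P. ext_cond_exp P (F k) (\<lambda>\<omega>. l (M2 t \<omega> - S t \<omega>)) \<omega> \<le> ereal (N t \<omega>)"
    using adm_E[OF Y] by metis
  define A where "A = {\<omega> \<in> space (F k). X \<omega> \<le> Y \<omega>}"
  have A: "A \<in> sets (F k)" unfolding A_def by measurable
  define M where "M t \<omega> = (if \<omega> \<in> A then M1 t \<omega> else M2 t \<omega>)" for t \<omega>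
  have "M k \<in> adm k N"
  proof (rule adm_I[OF _ \<open>k \<le> n\<close>])
    show "supermartingale Q F k n M"
      unfolding M_def[abs_def] by (rule Q.supermartingale_If[OF M1(2) M2(2) A \<open>k \<le> n\<close>])
    fix t assume t: "t \<in> {k + 1..n}"
    have "M1 t \<in> borel_measurable (F t)" "M2 t \<in> borel_measurable (F t)"
      using supermartingaleD(1)[OF M1(2), of t] supermartingaleD(1)[OF M2(2), of t] t by auto
    then have meas: "(\<lambda>\<omega>. l (M1 t \<omega> - S t \<omega>)) \<in> borel_measurable P" "(\<lambda>\<omega>. l (M2 t \<omega> - S t \<omega>)) \<in> borel_measurable P"
      using measurable_loss P.measurable_F t by auto
    have eq: "(\<lambda>\<omega>. l (M t \<omega> - S t \<omega>)) = (\<lambda>\<omega>. if \<omega> \<in> A then l (M1 t \<omega> - S t \<omega>) else l (M2 t \<omega> - S t \<omega>))"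
      by (auto simp: M_def)
    show "AE \<omega> in P. ext_cond_exp P (F k) (\<lambda>\<omega>. l (M t \<omega> - S t \<omega>)) \<omega> \<le> ereal (N t \<omega>)"
      unfolding eq using k.ext_cond_exp_If[OF A meas] M1(3)[OF t] M2(3)[OF t]
      by eventually_elim auto
  qed
  \<comment> \<open>\<open>M k\<close> is known to agree with the minimum on the space of
    \<open>P\<close> only; \<open>adm_mono\<close> passes to the minimum as a function on the whole
    type.\<close>
  then show ?thesis
  proof (rule adm_mono[OF _ \<open>k \<le> n\<close>])
    show "integrable Q (\<lambda>\<omega>. min (X \<omega>) (Y \<omega>))"
      using adm_integrable[OF \<open>k \<le> n\<close>] X Y by (intro integrable_min) auto
    show "AE \<omega> in P. M k \<omega> \<le> min (X \<omega>) (Y \<omega>)"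
      using AE_space
    proof eventually_elim
      case (elim \<omega>)
      with P.subalgebra_F[OF \<open>k \<le> n\<close>] show ?case
        by (auto simp: M_def A_def M1 M2 subalgebra_def)
    qed
  qed measurable
qed

section \<open>From the one-step problem to the original problem\<close>

text \<open>Prepending the \<open>Q\<close>-conditional expectation of \<open>M (Suc k)\<close>
  gives a supermartingale by the tower property under \<open>Q\<close>. The loss bounds use the
  tower property under \<open>P\<close>: given \<open>F (Suc k)\<close>, the loss at time
  \<open>t\<close> is bounded by \<open>NN t (Suc k)\<close>, whose conditional expectation given
  \<open>F k\<close> is at most \<open>NN t k\<close>, that is, \<open>N t\<close>.\<close>

lemma cond_exp_mem_adm:
  assumes "k < n" and M: "supermartingale Q F (Suc k) n M"
    and NN: "\<And>i. i \<in> {k + 1..n} \<Longrightarrow> generalized_supermartingale P F k i (NN i)"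
    and start: "\<And>i. i \<in> {k + 1..n} \<Longrightarrow> AE \<omega> in P. NN i k \<omega> = N i \<omega>"
    and first: "AE \<omega> in P. l (M (Suc k) \<omega> - S (Suc k) \<omega>) \<le> NN (Suc k) (Suc k) \<omega>"
    and later: "\<And>t. t \<in> {k + 2..n} \<Longrightarrow>
      AE \<omega> in P. ext_cond_exp P (F (Suc k)) (\<lambda>\<omega>. l (M t \<omega> - S t \<omega>)) \<omega> \<le> ereal (NN t (Suc k) \<omega>)"
  shows "real_cond_exp Q (F k) (M (Suc k)) \<in> adm k N"
proof -
  interpret Pk: sigma_finite_subalgebra P "F k" using \<open>k < n\<close> by (intro P.sigma_finite_F) auto
  interpret Pk1: sigma_finite_subalgebra P "F (Suc k)" using \<open>k < n\<close> by (intro P.sigma_finite_F) auto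
  interpret Qk: sigma_finite_subalgebra Q "F k" using \<open>k < n\<close> by (intro Q.sigma_finite_F) auto
  have int: "integrable Q (M t)" if "t \<in> {Suc k..n}" for t
    using supermartingaleD(2)[OF M that] .
  have M_k1: "integrable Q (M (Suc k))" using int \<open>k < n\<close> by auto
  define R where "R = real_cond_exp Q (F k) (M (Suc k))"
  have R: "R \<in> borel_measurable (F k)" "integrable Q R"
    unfolding R_def using Qk.real_cond_exp_int(1)[OF M_k1] by auto
  have sm: "supermartingale Q F k n (M(k := R))"
  proof (rule Q.supermartingale_fun_upd[OF M _ R])
    fix t assume t: "t \<in> {Suc k..n}"
    have "AE \<omega> in Q. real_cond_exp Q (F k) (real_cond_exp Q (F (Suc k)) (M t)) \<omega> = real_cond_exp Q (F k) (M t) \<omega>"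
      using \<open>k < n\<close> by (intro Qk.real_cond_exp_nested_subalg Q.subalgebra_F Q.subalgebra_F_F int t) auto
    moreover have "AE \<omega> in Q. real_cond_exp Q (F k) (real_cond_exp Q (F (Suc k)) (M t)) \<omega> \<le> R \<omega>"
      unfolding R_def
    proof (rule Qk.real_cond_exp_mono[OF _ _ M_k1])
      show "AE \<omega> in Q. real_cond_exp Q (F (Suc k)) (M t) \<omega> \<le> M (Suc k) \<omega>"
        by (rule supermartingaleD(3)[OF M]) (use t \<open>k < n\<close> in auto)
      show "integrable Q (real_cond_exp Q (F (Suc k)) (M t))"
        using \<open>k < n\<close> by (intro sigma_finite_subalgebra.real_cond_exp_int(1) Q.sigma_finite_F int t) auto
    qed
    ultimately show "AE \<omega> in Q. real_cond_exp Q (F k) (M t) \<omega> \<le> R \<omega>"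
      by eventually_elim simp
  qed (use \<open>k < n\<close> in auto)
  have "(M(k := R)) k \<in> adm k N"
  proof (rule adm_I[OF sm])
    show "k \<le> n" using \<open>k < n\<close> by simp
    fix t assume t: "t \<in> {k + 1..n}"
    define L where "L \<omega> = l (M t \<omega> - S t \<omega>)" for \<omega>
    have L_t: "L \<in> borel_measurable (F t)"
      unfolding L_def by (rule measurable_loss, rule supermartingaleD(1)[OF M]) (use t in auto)
    then have [measurable]: "L \<in> borel_measurable P" by (rule P.measurable_F) (use t in auto)
    have L_bound: "AE \<omega> in P. - c \<le> L \<omega>" using c by (simp add: L_def)
    have NN_t: "NN t (Suc k) \<in> borel_measurable (F (Suc k))"
      by (rule generalized_supermartingaleD(1)[OF NN[OF t]]) (use t in auto)
    then have [measurable]: "NN t (Suc k) \<in> borel_measurable P"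
      by (rule P.measurable_F) (use \<open>k < n\<close> in auto)
    \<comment> \<open>Brings both kinds of loss constraint into one form. At
      \<open>t = Suc k\<close> the loss equals its own conditional expectation and
      \<open>first\<close> applies; for larger \<open>t\<close> the bound is
      \<open>later\<close>.\<close>
    have step: "AE \<omega> in P. 0 \<le> NN t (Suc k) \<omega> + c \<and>
        nn_cond_exp P (F (Suc k)) (\<lambda>\<omega>. ennreal (L \<omega> + c)) \<omega> \<le> ennreal (NN t (Suc k) \<omega> + c)"
    proof (cases "t = Suc k")
      case True
      have "AE \<omega> in P. ennreal (L \<omega> + c) = nn_cond_exp P (F (Suc k)) (\<lambda>\<omega>. ennreal (L \<omega> + c)) \<omega>"
        using L_t True by (intro Pk1.nn_cond_exp_F_meas) auto
      then show ?thesis using first L_bound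
      proof eventually_elim
        case (elim \<omega>)
        have "L \<omega> \<le> NN t (Suc k) \<omega>" using elim(2) by (simp add: L_def True)
        with elim(3) elim(1)[symmetric] show ?case by (auto intro: ennreal_leI)
      qed
    next
      case False
      with t have "t \<in> {k + 2..n}" by auto
      from later[OF this, folded L_def]
        Pk1.ext_cond_exp_le_iff[OF c(1) L_bound \<open>L \<in> borel_measurable P\<close>, of "NN t (Suc k)"]
      show ?thesis by eventually_elim blast
    qed
    have "AE \<omega> in P. nn_cond_exp P (F k) (\<lambda>\<omega>. ennreal (L \<omega> + c)) \<omega> =
        nn_cond_exp P (F k) (nn_cond_exp P (F (Suc k)) (\<lambda>\<omega>. ennreal (L \<omega> + c))) \<omega>"
      using \<open>k < n\<close> by (intro Pk.nn_cond_exp_nested_subalg P.subalgebra_F P.subalgebra_F_F) auto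
    moreover have "AE \<omega> in P. nn_cond_exp P (F k) (nn_cond_exp P (F (Suc k)) (\<lambda>\<omega>. ennreal (L \<omega> + c))) \<omega>
        \<le> nn_cond_exp P (F k) (\<lambda>\<omega>. ennreal (NN t (Suc k) \<omega> + c)) \<omega>"
      by (rule Pk.nn_cond_exp_mono, use step in eventually_elim) auto
    \<comment> \<open>The lower bound on \<open>NN t (Suc k)\<close> is inherited from the losses.
      It allows the generalized supermartingale inequality to be rewritten in
      \<open>ennreal\<close>.\<close>
    moreover have NN_bound: "AE \<omega> in P. - c \<le> NN t (Suc k) \<omega>"
      using step by eventually_elim auto
    have "AE \<omega> in P. ext_cond_exp P (F k) (NN t (Suc k)) \<omega> \<le> ereal (NN t k \<omega>)"
      by (rule generalized_supermartingaleD(2)[OF NN[OF t]]) (use t in auto)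
    moreover note Pk.ext_cond_exp_le_iff[OF c(1) NN_bound \<open>NN t (Suc k) \<in> borel_measurable P\<close>, of "NN t k"]
      Pk.ext_cond_exp_le_iff[OF c(1) L_bound \<open>L \<in> borel_measurable P\<close>, of "NN t k"] start[OF t]
    ultimately have "AE \<omega> in P. ext_cond_exp P (F k) L \<omega> \<le> ereal (N t \<omega>)"
    proof eventually_elim
      case (elim \<omega>)
      then have "0 \<le> NN t k \<omega> + c" "nn_cond_exp P (F k) (\<lambda>\<omega>. ennreal (L \<omega> + c)) \<omega> \<le> ennreal (NN t k \<omega> + c)"
        by (auto intro: order_trans)
      with elim show ?case by simp
    qed
    then show "AE \<omega> in P. ext_cond_exp P (F k) (\<lambda>\<omega>. l ((M(k := R)) t \<omega> - S t \<omega>)) \<omega> \<le> ereal (N t \<omega>)"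
      using t by (simp add: L_def[abs_def])
  qed
  then show ?thesis by (simp add: R_def)
qed

text \<open>Formulated for the generalized notion, the weaker of the two, so that the bound also
  covers one-step values taken with genuine supermartingales.\<close>

lemma value_function_le_one_step_values:
  assumes "k < n" and X: "X \<in> one_step_values generalized_supermartingale P Q F S l n k N"
  shows "AE \<omega> in P. value_function P Q F S l n k N \<omega> \<le> ereal (X \<omega>)"
proof -
  interpret Qk: sigma_finite_subalgebra Q "F k" using \<open>k < n\<close> by (intro Q.sigma_finite_F) auto
  obtain M' NN where M': "M' \<in> borel_measurable (F (k + 1))" "integrable Q M'"
    and NN: "\<And>i. i \<in> {k + 1..n} \<Longrightarrow> generalized_supermartingale P F k i (NN i)"
    and X_eq: "AE \<omega> in P. real_cond_exp Q (F k) M' \<omega> = X \<omega>"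
    and start: "\<And>i. i \<in> {k + 1..n} \<Longrightarrow> AE \<omega> in P. NN i k \<omega> = N i \<omega>"
    and first: "AE \<omega> in P. NN (k + 1) (k + 1) \<omega> \<ge> l (M' \<omega> - S (k + 1) \<omega>)"
    and value_le: "AE \<omega> in P. ereal (M' \<omega>) \<ge> value_function P Q F S l n (k + 1) (\<lambda>i. NN i (k + 1)) \<omega>"
    using X unfolding one_step_values_def
    by (elim CollectE conjE exE) (rule that; (assumption | drule bspec, assumption+))
  define V where "V = value_function P Q F S l n k N"
  have V: "V \<in> borel_measurable P" "\<And>Y. Y \<in> adm k N \<Longrightarrow> AE \<omega> in P. V \<omega> \<le> ereal (Y \<omega>)"
    using is_ess_inf_value_function[OF \<open>k < n\<close>, of N] by (auto simp: is_ess_inf_def V_def)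
  \<comment> \<open>A continuation from time \<open>Suc k\<close> that starts above
    \<open>M'\<close> and costs at most \<open>e\<close> more in \<open>Q\<close>-mean. For
    \<open>Suc k = n\<close> no later constraints remain and \<open>M'\<close> itself serves;
    otherwise it comes from \<open>integral_max_approx\<close>.\<close>
  have approx: "\<exists>M. supermartingale Q F (Suc k) n M \<and> (AE \<omega> in P. M' \<omega> \<le> M (Suc k) \<omega>) \<and>
      (\<integral>\<omega>. M (Suc k) \<omega> \<partial>Q) \<le> (\<integral>\<omega>. M' \<omega> \<partial>Q) + e \<and>
      (\<forall>t\<in>{k + 2..n}. AE \<omega> in P. ext_cond_exp P (F (Suc k)) (\<lambda>\<omega>. l (M t \<omega> - S t \<omega>)) \<omega> \<le> ereal (NN t (Suc k) \<omega>))"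
    if "0 < e" for e
  proof (cases "Suc k = n")
    case True
    interpret Qn: sigma_finite_subalgebra Q "F n" by (intro Q.sigma_finite_F) auto
    have "supermartingale Q F (Suc k) n (\<lambda>_. M')"
      unfolding supermartingale_def
    proof (intro conjI ballI)
      fix s t assume "s \<in> {Suc k..n}" "t \<in> {s..n}"
      then have "s = n" "t = n" using True by auto
      moreover have "AE \<omega> in Q. real_cond_exp Q (F n) M' \<omega> = M' \<omega>"
        using M' True by (intro Qn.real_cond_exp_F_meas) auto
      ultimately show "AE \<omega> in Q. real_cond_exp Q (F s) M' \<omega> \<le> M' \<omega>"
        by (auto elim: eventually_mono)
    qed (use M' True in auto)
    with True \<open>0 < e\<close> show ?thesis by (intro exI[of _ "\<lambda>_. M'"]) auto
  next
    case False
    then have "Suc k < n" using \<open>k < n\<close> by simp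
    define \<Phi> where "\<Phi> = adm (Suc k) (\<lambda>i. NN i (Suc k))"
    have ess: "is_ess_inf P \<Phi> (value_function P Q F S l n (Suc k) (\<lambda>i. NN i (Suc k)))"
      unfolding \<Phi>_def by (rule is_ess_inf_value_function[OF \<open>Suc k < n\<close>])
    have lower: "AE \<omega> in P. Z \<omega> \<le> ereal (M' \<omega>)"
      if "Z \<in> borel_measurable P" "\<And>Y. Y \<in> \<Phi> \<Longrightarrow> AE \<omega> in P. Z \<omega> \<le> ereal (Y \<omega>)" for Z
    proof -
      have "AE \<omega> in P. Z \<omega> \<le> value_function P Q F S l n (Suc k) (\<lambda>i. NN i (Suc k)) \<omega>"
        using ess that unfolding is_ess_inf_def by blast
      with value_le show ?thesis unfolding Suc_eq_plus1 by eventually_elim (rule order_trans)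
    qed
    \<comment> \<open>For an empty family the constant infinity would be a lower bound, whereas the
      real-valued \<open>M'\<close> dominates every lower bound.\<close>
    have "\<Phi> \<noteq> {}"
    proof
      assume "\<Phi> = {}"
      with lower[of "\<lambda>_. \<infinity>"] show False by (simp add: P.AE_False)
    qed
    have "\<exists>Y\<in>\<Phi>. (\<integral>\<omega>. max (Y \<omega>) (M' \<omega>) \<partial>Q) < (\<integral>\<omega>. M' \<omega> \<partial>Q) + e"
    proof (rule Q.integral_max_approx[OF \<open>\<Phi> \<noteq> {}\<close> _ _ M'(2) _ \<open>0 < e\<close>])
      show "integrable Q Y" if "Y \<in> \<Phi>" for Y
        using adm_integrable[OF less_imp_le[OF \<open>Suc k < n\<close>]] that unfolding \<Phi>_def .
      show "(\<lambda>\<omega>. min (X \<omega>) (Y \<omega>)) \<in> \<Phi>" if "X \<in> \<Phi>" "Y \<in> \<Phi>" for X Y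
        using adm_min[OF _ _ less_imp_le[OF \<open>Suc k < n\<close>]] that unfolding \<Phi>_def .
      show "AE \<omega> in Q. Z \<omega> \<le> ereal (M' \<omega>)"
        if "Z \<in> borel_measurable Q" "\<And>Y. Y \<in> \<Phi> \<Longrightarrow> AE \<omega> in Q. Z \<omega> \<le> ereal (Y \<omega>)" for Z
        using lower[of Z] that unfolding AE_Q measurable_Q .
    qed
    then obtain Y where Y: "Y \<in> \<Phi>" "(\<integral>\<omega>. max (Y \<omega>) (M' \<omega>) \<partial>Q) < (\<integral>\<omega>. M' \<omega> \<partial>Q) + e"
      by blast
    \<comment> \<open>The maximum stays admissible and lies above \<open>M'\<close>, so that
      monotonicity of \<open>l\<close> can later transfer the first loss constraint from
      \<open>M'\<close>.\<close>
    have "(\<lambda>\<omega>. max (Y \<omega>) (M' \<omega>)) \<in> adm (Suc k) (\<lambda>i. NN i (Suc k))"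
    proof (rule adm_mono[OF Y(1)[unfolded \<Phi>_def]])
      have "Y \<in> borel_measurable (F (Suc k))" using Y(1) by (auto simp: \<Phi>_def admissible_values_def)
      with M'(1) show "(\<lambda>\<omega>. max (Y \<omega>) (M' \<omega>)) \<in> borel_measurable (F (Suc k))" by simp
      show "integrable Q (\<lambda>\<omega>. max (Y \<omega>) (M' \<omega>))"
        using adm_integrable[OF _ Y(1)[unfolded \<Phi>_def]] M'(2) \<open>k < n\<close> by (intro integrable_max) auto
    qed (use \<open>k < n\<close> in auto)
    then obtain M where M: "M (Suc k) = (\<lambda>\<omega>. max (Y \<omega>) (M' \<omega>))" "supermartingale Q F (Suc k) n M"
      "\<And>t. t \<in> {Suc k + 1..n} \<Longrightarrow>
        AE \<omega> in P. ext_cond_exp P (F (Suc k)) (\<lambda>\<omega>. l (M t \<omega> - S t \<omega>)) \<omega> \<le> ereal (NN t (Suc k) \<omega>)"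
      by (rule adm_E) blast
    show ?thesis
    proof (intro exI[of _ M] conjI ballI)
      show "supermartingale Q F (Suc k) n M" by (rule M(2))
      show "AE \<omega> in P. M' \<omega> \<le> M (Suc k) \<omega>" by (simp add: M(1))
      show "(\<integral>\<omega>. M (Suc k) \<omega> \<partial>Q) \<le> (\<integral>\<omega>. M' \<omega> \<partial>Q) + e" using Y(2) by (simp add: M(1))
    qed (use M(3) in simp)
  qed
  \<comment> \<open>Conditioning on \<open>F k\<close> preserves order and mean. The admissible
    values \<open>R\<close> below therefore dominate the conditional expectation of
    \<open>M'\<close> almost surely and exceed it in mean by at most \<open>e\<close>.\<close>
  have "AE \<omega> in Q. V \<omega> \<le> ereal (real_cond_exp Q (F k) M' \<omega>)"
  proof (rule Q.AE_le_if_integral_approx)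
    show "V \<in> borel_measurable Q" using V(1) by (simp add: measurable_Q)
    show "integrable Q (real_cond_exp Q (F k) M')" by (rule Qk.real_cond_exp_int(1)[OF M'(2)])
    fix e :: real assume "0 < e"
    from approx[OF this] obtain M where M: "supermartingale Q F (Suc k) n M" "AE \<omega> in P. M' \<omega> \<le> M (Suc k) \<omega>"
        "(\<integral>\<omega>. M (Suc k) \<omega> \<partial>Q) \<le> (\<integral>\<omega>. M' \<omega> \<partial>Q) + e"
        "\<And>t. t \<in> {k + 2..n} \<Longrightarrow>
          AE \<omega> in P. ext_cond_exp P (F (Suc k)) (\<lambda>\<omega>. l (M t \<omega> - S t \<omega>)) \<omega> \<le> ereal (NN t (Suc k) \<omega>)"
      by (elim exE conjE) (rule that; (assumption | drule bspec, assumption+))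
    define R where "R = real_cond_exp Q (F k) (M (Suc k))"
    have int: "integrable Q (M (Suc k))"
      by (rule supermartingaleD(2)[OF M(1)]) (use \<open>k < n\<close> in auto)
    have "R \<in> adm k N"
      unfolding R_def
    proof (rule cond_exp_mem_adm[OF \<open>k < n\<close> M(1) NN start _ M(4)])
      show "AE \<omega> in P. l (M (Suc k) \<omega> - S (Suc k) \<omega>) \<le> NN (Suc k) (Suc k) \<omega>"
        using first M(2)
      proof eventually_elim
        case (elim \<omega>)
        have "l (M (Suc k) \<omega> - S (Suc k) \<omega>) \<le> l (M' \<omega> - S (Suc k) \<omega>)"
          using elim(2) by (intro antimonoD[OF antimono_l]) simp
        with elim(1) show ?case by simp
      qed
    qed
    then have "AE \<omega> in Q. V \<omega> \<le> ereal (R \<omega>)" unfolding AE_Q by (rule V(2))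
    moreover have "AE \<omega> in Q. real_cond_exp Q (F k) M' \<omega> \<le> R \<omega>"
      unfolding R_def by (rule Qk.real_cond_exp_mono[OF _ M'(2) int]) (use M(2) in \<open>simp add: AE_Q\<close>)
    moreover have "(\<integral>\<omega>. R \<omega> \<partial>Q) \<le> (\<integral>\<omega>. real_cond_exp Q (F k) M' \<omega> \<partial>Q) + e"
      unfolding R_def Qk.real_cond_exp_int(2)[OF int] Qk.real_cond_exp_int(2)[OF M'(2)] by (rule M(3))
    moreover have "integrable Q R" unfolding R_def by (rule Qk.real_cond_exp_int(1)[OF int])
    ultimately show "\<exists>R. integrable Q R \<and> (AE \<omega> in Q. V \<omega> \<le> ereal (R \<omega>)) \<and>
        (AE \<omega> in Q. real_cond_exp Q (F k) M' \<omega> \<le> R \<omega>) \<and>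
        (\<integral>\<omega>. R \<omega> \<partial>Q) \<le> (\<integral>\<omega>. real_cond_exp Q (F k) M' \<omega> \<partial>Q) + e"
      by blast
  qed
  then show ?thesis using X_eq unfolding AE_Q V_def by eventually_elim simp
qed

section \<open>From the original problem to the one-step problem\<close>

text \<open>One construction serves both notions of supermartingale. The processes \<open>NN\<close>
  are the same, and the alternatives for \<open>SM\<close> differ only in the check
  \<open>sm_NN\<close>, where integrable initial values yield genuine supermartingales.\<close>

lemma adm_subset_one_step_values:
  assumes "k < n" and N: "\<And>i. i \<in> {k + 1..n} \<Longrightarrow> N i \<in> borel_measurable (F k)"
    and SM: "SM = generalized_supermartingale \<or>
      SM = supermartingale \<and> (\<forall>i\<in>{k + 1..n}. integrable P (N i))"
  shows "adm k N \<subseteq> one_step_values SM P Q F S l n k N"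
proof
  fix X assume X: "X \<in> adm k N"
  have PF: "sigma_finite_subalgebra P (F t)" if "t \<le> n" for t using that by (rule P.sigma_finite_F)
  interpret Pk: sigma_finite_subalgebra P "F k" using \<open>k < n\<close> by (intro PF) auto
  interpret Pk1: sigma_finite_subalgebra P "F (Suc k)" using \<open>k < n\<close> by (intro PF) auto
  interpret Qk: sigma_finite_subalgebra Q "F k" using \<open>k < n\<close> by (intro Q.sigma_finite_F) auto
  obtain M where M: "M k = X" "supermartingale Q F k n M"
    "\<And>t. t \<in> {k + 1..n} \<Longrightarrow> AE \<omega> in P. ext_cond_exp P (F k) (\<lambda>\<omega>. l (M t \<omega> - S t \<omega>)) \<omega> \<le> ereal (N t \<omega>)"
    using adm_E[OF X] by metis
  have int_M: "integrable Q (M (Suc k))"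
    by (rule supermartingaleD(2)[OF M(2)]) (use \<open>k < n\<close> in auto)
  have X_F: "X \<in> borel_measurable (F k)" using X by (simp add: admissible_values_def)
  have int_X: "integrable Q X" using X \<open>k < n\<close> by (intro adm_integrable) auto
  \<comment> \<open>\<open>D\<close> is the first increment of the compensator of \<open>M\<close>; adding it to all later values makes the
    first step a martingale step and, as \<open>D \<ge> 0\<close>, only decreases the losses.\<close>
  define D where "D \<omega> = X \<omega> - real_cond_exp Q (F k) (M (Suc k)) \<omega>" for \<omega>
  have D_F: "D \<in> borel_measurable (F k)" unfolding D_def using X_F by simp
  have int_D: "integrable Q D"
    unfolding D_def using int_X Qk.real_cond_exp_int(1)[OF int_M] by simp
  have "AE \<omega> in Q. real_cond_exp Q (F k) (M (Suc k)) \<omega> \<le> M k \<omega>"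
    by (rule supermartingaleD(3)[OF M(2)]) (use \<open>k < n\<close> in auto)
  then have D_nonneg: "AE \<omega> in P. 0 \<le> D \<omega>"
    unfolding AE_Q by eventually_elim (simp add: D_def M(1))
  define M' where "M' t \<omega> = M t \<omega> + D \<omega>" for t \<omega>
  have "supermartingale Q F (Suc k) n M"
    using M(2) unfolding supermartingale_def by auto
  then have sm': "supermartingale Q F (Suc k) n M'"
    unfolding M'_def[abs_def] using D_F \<open>k < n\<close>
    by (intro Q.supermartingale_add int_D Q.measurable_F_mono[OF D_F]) auto
  define L where "L i \<omega> = l (M' i \<omega> - S i \<omega>)" for i \<omega>
  have L_F: "L i \<in> borel_measurable (F i)" if "i \<in> {k + 1..n}" for i
    unfolding L_def by (rule measurable_loss, rule supermartingaleD(1)[OF sm']) (use that in auto)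
  have L_P: "L i \<in> borel_measurable P" if "i \<in> {k + 1..n}" for i
    by (rule P.measurable_F[OF L_F[OF that]]) (use that in auto)
  have L_bound: "- c \<le> L i \<omega>" for i \<omega> by (simp add: L_def c)
  \<comment> \<open>The conditional expectation of the shifted loss is kept in
    \<open>ennreal\<close>, so that the tower property can be applied before finiteness is
    known.\<close>
  define W where "W i t = nn_cond_exp P (F t) (\<lambda>\<omega>. ennreal (L i \<omega> + c))" for i t
  have W_P: "W i t \<in> borel_measurable P" and W_F: "W i t \<in> borel_measurable (F t)" for i t
    unfolding W_def by auto
  have W_nested: "AE \<omega> in P. nn_cond_exp P (F s) (W i t) \<omega> = W i s \<omega>"
    if "i \<in> {k + 1..n}" "s \<le> t" "t \<le> n" for i s t
  proof -
    interpret s: sigma_finite_subalgebra P "F s" using that by (intro PF) auto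
    have "(\<lambda>\<omega>. ennreal (L i \<omega> + c)) \<in> borel_measurable P" using L_P[OF that(1)] by simp
    from s.nn_cond_exp_nested_subalg[OF P.subalgebra_F P.subalgebra_F_F this, of t] that
    show ?thesis unfolding W_def by (auto elim: eventually_mono)
  qed
  have W_k: "AE \<omega> in P. 0 \<le> N i \<omega> + c \<and> W i k \<omega> \<le> ennreal (N i \<omega> + c)" if i: "i \<in> {k + 1..n}" for i
  proof -
    have meas: "(\<lambda>\<omega>. l (M i \<omega> - S i \<omega>)) \<in> borel_measurable P"
      by (rule P.measurable_F, rule measurable_loss, rule supermartingaleD(1)[OF M(2)]) (use i in auto)
    have "AE \<omega> in P. L i \<omega> \<le> l (M i \<omega> - S i \<omega>)"
      using D_nonneg by eventually_elim (auto simp: L_def M'_def intro!: antimonoD[OF antimono_l])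
    from Pk.ext_cond_exp_mono[OF this L_P[OF i] meas] M(3)[OF i]
      Pk.ext_cond_exp_le_iff[OF c(1) AE_I2[OF L_bound] L_P[OF i], of "N i"]
    show ?thesis unfolding W_def
    proof eventually_elim
      case (elim \<omega>)
      from order_trans[OF elim(1,2)] elim(3) show ?case by blast
    qed
  qed
  \<comment> \<open>Finiteness passes from time \<open>k\<close> to later times: given
    \<open>F k\<close>, the conditional expectation of \<open>W i t\<close> is \<open>W i k\<close>,
    which \<open>W_k\<close> bounds by a real number.\<close>
  have W_finite: "AE \<omega> in P. W i t \<omega> < \<infinity>" if i: "i \<in> {k + 1..n}" and t: "k \<le> t" "t \<le> n" for i t
  proof (rule Pk.AE_finite_if_nn_cond_exp_finite[OF _ W_P])
    show "AE \<omega> in P. nn_cond_exp P (F k) (W i t) \<omega> < \<infinity>"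
      using W_nested[OF i t] W_k[OF i]
    proof eventually_elim
      case (elim \<omega>)
      then have "nn_cond_exp P (F k) (W i t) \<omega> \<le> ennreal (N i \<omega> + c)" by simp
      also have "\<dots> < \<infinity>" by simp
      finally show ?case .
    qed
  qed
  \<comment> \<open>At time \<open>k\<close> the prescribed value \<open>N i\<close> replaces
    \<open>W i k - c\<close>, which it dominates by \<open>W_k\<close>; this possible drop is why
    \<open>NN i\<close> is a supermartingale and not a martingale in general. At later times up to
    \<open>n\<close>, \<open>W_finite\<close> makes the conversion by \<open>enn2real\<close>
    lossless almost surely.\<close>
  define NN where "NN i t = (if t = k then N i else (\<lambda>\<omega>. enn2real (W i t \<omega>) - c))" for i t
  have NN_F: "NN i t \<in> borel_measurable (F t)" if "i \<in> {k + 1..n}" for i t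
    using N[OF that] W_F[of i t] by (auto simp: NN_def)
  have NN_bound: "AE \<omega> in P. - c \<le> NN i t \<omega>" if i: "i \<in> {k + 1..n}" for i t
  proof (cases "t = k")
    case True
    from W_k[OF i] show ?thesis by eventually_elim (auto simp: NN_def True)
  qed (simp add: NN_def)
  have NN_W: "AE \<omega> in P. ennreal (NN i t \<omega> + c) = W i t \<omega>" if "i \<in> {k + 1..n}" "k < t" "t \<le> n" for i t
    using W_finite[OF that(1) less_imp_le[OF that(2)] that(3)] that(2)
    by (auto simp: NN_def elim: eventually_mono)
  have NN_le: "AE \<omega> in P. nn_cond_exp P (F s) (\<lambda>\<omega>. ennreal (NN i t \<omega> + c)) \<omega> \<le> ennreal (NN i s \<omega> + c)"
    if i: "i \<in> {k + 1..n}" and s: "s \<in> {k..i}" and t: "t \<in> {s..i}" for i s t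
  proof (cases "t = k")
    case True
    with s t have "s = k" by simp
    have "(\<lambda>\<omega>. ennreal (NN i k \<omega> + c)) \<in> borel_measurable (F k)"
      using NN_F[OF i, of k] by simp
    from Pk.nn_cond_exp_F_meas[OF this] show ?thesis
      unfolding True \<open>s = k\<close> by eventually_elim simp
  next
    case False
    then have t': "k < t" "t \<le> n" and s': "s \<le> t" "s \<le> n" using i s t by auto
    interpret s: sigma_finite_subalgebra P "F s" using s' by (intro PF)
    have NN_P: "NN i t \<in> borel_measurable P" by (rule P.measurable_F[OF NN_F[OF i] t'(2)])
    have "AE \<omega> in P. nn_cond_exp P (F s) (\<lambda>\<omega>. ennreal (NN i t \<omega> + c)) \<omega> = nn_cond_exp P (F s) (W i t) \<omega>"
      by (rule s.nn_cond_exp_cong[OF NN_W[OF i t']]) (use NN_P W_P in auto)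
    moreover have "AE \<omega> in P. W i s \<omega> \<le> ennreal (NN i s \<omega> + c)"
    proof (cases "s = k")
      case True
      from W_k[OF i] show ?thesis by eventually_elim (simp add: NN_def True)
    next
      case False
      with s have "k < s" by simp
      from NN_W[OF i this s'(2)] show ?thesis by eventually_elim simp
    qed
    ultimately show ?thesis using W_nested[OF i s'(1) t'(2)] by eventually_elim simp
  qed
  have sm_NN: "SM P F k i (NN i)" if i: "i \<in> {k + 1..n}" for i
    using SM
  proof
    assume "SM = generalized_supermartingale"
    moreover have "generalized_supermartingale P F k i (NN i)"
      by (rule P.generalized_supermartingale_lower_boundedI[OF _ c(1) NN_F[OF i] NN_bound[OF i] NN_le[OF i]])
         (use i in auto)
    ultimately show ?thesis by simp
  next
    assume *: "SM = supermartingale \<and> (\<forall>i\<in>{k + 1..n}. integrable P (N i))"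
    have "supermartingale P F k i (NN i)"
      by (rule P.supermartingale_lower_boundedI[OF _ _ c(1) NN_F[OF i] NN_bound[OF i] NN_le[OF i]])
         (use i * in \<open>auto simp: NN_def\<close>)
    with * show ?thesis by simp
  qed
  have k1: "Suc k \<in> {k + 1..n}" using \<open>k < n\<close> by auto
  \<comment> \<open>The loss at time \<open>Suc k\<close> is \<open>F (Suc k)\<close>-measurable, so
    the first loss constraint holds with equality.\<close>
  have "(\<lambda>\<omega>. ennreal (L (Suc k) \<omega> + c)) \<in> borel_measurable (F (Suc k))"
    using L_F[OF k1] by simp
  from Pk1.nn_cond_exp_F_meas[OF this]
  have first: "AE \<omega> in P. l (M' (Suc k) \<omega> - S (Suc k) \<omega>) \<le> NN (Suc k) (Suc k) \<omega>"
  proof eventually_elim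
    case (elim \<omega>)
    have "enn2real (W (Suc k) (Suc k) \<omega>) = L (Suc k) \<omega> + c"
      using L_bound[of "Suc k" \<omega>] by (simp add: W_def flip: elim)
    then show ?case by (simp add: NN_def L_def)
  qed
  \<comment> \<open>The shifted process continues from \<open>M' (Suc k)\<close> and meets the
    bounds \<open>NN t (Suc k)\<close> by their very construction. At \<open>Suc k = n\<close> the
    convention \<open>-\<infinity>\<close> settles the claim.\<close>
  have value_le: "AE \<omega> in P. value_function P Q F S l n (Suc k) (\<lambda>i. NN i (Suc k)) \<omega> \<le> ereal (M' (Suc k) \<omega>)"
  proof (cases "Suc k < n")
    case True
    have "M' (Suc k) \<in> adm (Suc k) (\<lambda>i. NN i (Suc k))"
    proof (rule adm_I[OF sm'])
      fix t assume "t \<in> {Suc k + 1..n}"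
      then have t: "t \<in> {k + 1..n}" by auto
      from Pk1.ext_cond_exp_le_iff[OF c(1) AE_I2[OF L_bound] L_P[OF t], of "NN t (Suc k)"]
        NN_W[OF t, of "Suc k"] NN_bound[OF t, of "Suc k"] \<open>k < n\<close>
      have "AE \<omega> in P. ext_cond_exp P (F (Suc k)) (L t) \<omega> \<le> ereal (NN t (Suc k) \<omega>)"
        unfolding W_def by (auto elim: eventually_elim2)
      then show "AE \<omega> in P. ext_cond_exp P (F (Suc k)) (\<lambda>\<omega>. l (M' t \<omega> - S t \<omega>)) \<omega> \<le> ereal (NN t (Suc k) \<omega>)"
        by (simp add: L_def[abs_def])
    qed (use True in auto)
    with is_ess_inf_value_function[OF True] show ?thesis unfolding is_ess_inf_def by blast
  next
    case False
    then show ?thesis by (simp add: value_function_def)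
  qed
  have "AE \<omega> in Q. real_cond_exp Q (F k) (\<lambda>\<omega>. M (Suc k) \<omega> + D \<omega>) \<omega> = X \<omega>"
    using Qk.real_cond_exp_add[OF int_M int_D] Qk.real_cond_exp_F_meas[OF int_D D_F]
    by eventually_elim (simp add: D_def)
  then have mart: "AE \<omega> in P. real_cond_exp Q (F k) (M' (Suc k)) \<omega> = X \<omega>"
    by (simp add: AE_Q M'_def[abs_def])
  show "X \<in> one_step_values SM P Q F S l n k N"
    unfolding one_step_values_def Suc_eq_plus1[symmetric]
  proof (intro CollectI conjI exI[of _ "M' (Suc k)"] exI[of _ NN] ballI)
    show "X \<in> borel_measurable (F k)" by (rule X_F)
    show "M' (Suc k) \<in> borel_measurable (F (Suc k))" "integrable Q (M' (Suc k))"
      using supermartingaleD(1,2)[OF sm', of "Suc k"] \<open>k < n\<close> by auto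
    show "AE \<omega> in P. NN i k \<omega> = N i \<omega>" for i by (simp add: NN_def)
  qed (use mart first value_le sm_NN in auto)
qed

section \<open>Equality of the two essential infima\<close>

lemma one_step_values_supermartingale_subset:
  "one_step_values supermartingale P Q F S l n k N \<subseteq> one_step_values generalized_supermartingale P Q F S l n k N"
proof -
  have "\<forall>i\<in>{k + 1..n}. generalized_supermartingale P F k i (NN i)"
    if "\<forall>i\<in>{k + 1..n}. supermartingale P F k i (NN i)" for NN
    using that P.supermartingale_imp_generalized by (meson atLeastAtMost_iff)
  then show ?thesis unfolding one_step_values_def by blast
qed

text \<open>The family of one-step values contains the admissible values, so its essential infimum
  is not larger. Conversely the value function is a lower bound of the larger family.\<close>

lemma value_function_eq_ess_inf_one_step_values:
  assumes "k < n" and N: "\<And>i. i \<in> {k + 1..n} \<Longrightarrow> N i \<in> borel_measurable (F k)"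
    and SM: "SM = generalized_supermartingale \<or>
      SM = supermartingale \<and> (\<forall>i\<in>{k + 1..n}. integrable P (N i))"
  shows "AE \<omega> in P. value_function P Q F S l n k N \<omega> = ess_inf P (one_step_values SM P Q F S l n k N) \<omega>"
proof -
  define \<Phi> where "\<Phi> = one_step_values SM P Q F S l n k N"
  have sub: "adm k N \<subseteq> \<Phi>"
    unfolding \<Phi>_def by (rule adm_subset_one_step_values[OF assms])
  have "\<Phi> \<subseteq> borel_measurable P"
  proof
    fix X assume "X \<in> \<Phi>"
    then have "X \<in> borel_measurable (F k)" by (simp add: \<Phi>_def one_step_values_def)
    then show "X \<in> borel_measurable P" by (rule P.measurable_F) (use \<open>k < n\<close> in simp)
  qed
  then have ess: "is_ess_inf P \<Phi> (ess_inf P \<Phi>)" by (rule P.is_ess_inf_ess_inf)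
  have val: "is_ess_inf P (adm k N) (value_function P Q F S l n k N)"
    by (rule is_ess_inf_value_function[OF \<open>k < n\<close>])
  have "AE \<omega> in P. value_function P Q F S l n k N \<omega> \<le> ereal (X \<omega>)" if "X \<in> \<Phi>" for X
    using value_function_le_one_step_values[OF \<open>k < n\<close>, of X N] that SM
      one_step_values_supermartingale_subset[of k N] by (auto simp: \<Phi>_def)
  with val ess have "AE \<omega> in P. value_function P Q F S l n k N \<omega> \<le> ess_inf P \<Phi> \<omega>"
    unfolding is_ess_inf_def by blast
  moreover have "AE \<omega> in P. ess_inf P \<Phi> \<omega> \<le> value_function P Q F S l n k N \<omega>"
    using val ess sub unfolding is_ess_inf_def by blast
  ultimately show ?thesis unfolding \<Phi>_def by eventually_elim (rule antisym)
qed

end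

text \<open>A genuine supermartingale starting at \<open>N i\<close> forces \<open>N i\<close> to be
  integrable under \<open>P\<close>. Arbitrary \<open>N i\<close> are therefore paired with the
  generalized notion, and integrable ones with the genuine notion as well.\<close>

theorem theorem1:
  fixes P Q :: "'a measure"
    and F :: "nat \<Rightarrow> 'a measure"
    and p S N :: "nat \<Rightarrow> 'a \<Rightarrow> real"
    and l :: "real \<Rightarrow> real"
    and n k :: nat
  assumes "prob_space P" and "prob_space Q"
    and "sets Q = sets P" and "absolutely_continuous P Q" and "absolutely_continuous Q P"
    and "1 \<le> n"
    and "\<And>i. i \<le> n \<Longrightarrow> subalgebra P (F i)"
    and "\<And>i j. i \<le> j \<Longrightarrow> j \<le> n \<Longrightarrow> sets (F i) \<subseteq> sets (F j)"
    and "\<And>A. A \<in> sets (F 0) \<Longrightarrow> measure P A = 0 \<or> measure P A = 1"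
    and "\<And>i. 1 \<le> i \<Longrightarrow> i \<le> n \<Longrightarrow> p i \<in> borel_measurable (F i)"
    and "\<And>i. 1 \<le> i \<Longrightarrow> i \<le> n \<Longrightarrow> integrable Q (p i)"
    and "S = (\<lambda>j \<omega>. \<Sum>i = 1..j. p i \<omega>)"
    and "convex_on UNIV l" and "antimono l" and "bdd_below (range l)"
    and "k < n"
    and "\<And>i. k + 1 \<le> i \<Longrightarrow> i \<le> n \<Longrightarrow> N i \<in> borel_measurable (F k)"
  shows "(AE \<omega> in P. value_function P Q F S l n k N \<omega> =
            ess_inf P (one_step_values generalized_supermartingale P Q F S l n k N) \<omega>) \<and>
         ((\<forall>i\<in>{k+1..n}. integrable P (N i)) \<longrightarrow>
          (AE \<omega> in P. value_function P Q F S l n k N \<omega> =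
            ess_inf P (one_step_values supermartingale P Q F S l n k N) \<omega>))"
proof -
  interpret P: prob_space P by fact
  interpret Q: prob_space Q by fact
  obtain b where b: "\<And>x. b \<le> l x"
    using \<open>bdd_below (range l)\<close> by (auto simp: bdd_below_def)
  have subalg_Q: "subalgebra Q (F i)" if "i \<le> n" for i
    using assms(7)[OF that] sets_eq_imp_space_eq[OF assms(3)] assms(3) by (simp add: subalgebra_def)
  have AE_Q: "(AE \<omega> in Q. R \<omega>) \<longleftrightarrow> (AE \<omega> in P. R \<omega>)" for R
    using absolutely_continuous_AE[OF assms(3,4)] absolutely_continuous_AE[OF assms(3)[symmetric] assms(5)]
    by blast
  have S: "S j \<in> borel_measurable (F j)" if "j \<le> n" for j
    unfolding assms(12)
  proof (rule borel_measurable_sum)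
    fix i assume i: "i \<in> {1..j}"
    have "subalgebra (F j) (F i)"
      using assms(7)[of i] assms(7)[of j] assms(8)[of i j] i that by (simp add: subalgebra_def)
    then show "p i \<in> borel_measurable (F j)"
      by (rule measurable_from_subalg) (use assms(10)[of i] i that in auto)
  qed
  \<comment> \<open>The lower bound \<open>b\<close> of \<open>l\<close> may be positive; the
    maximum with 0 keeps the shift constant nonnegative.\<close>
  interpret equivalent_filtered_measures P Q F n S l "max 0 (- b)"
  proof unfold_locales
    show "- max 0 (- b) \<le> l x" for x using b[of x] by (simp add: max_def)
  qed (use assms(7) subalg_Q assms(8) assms(3) AE_Q S assms(14) in auto)
  have "AE \<omega> in P. value_function P Q F S l n k N \<omega> = ess_inf P (one_step_values SM P Q F S l n k N) \<omega>"
    if "SM = generalized_supermartingale \<or> SM = supermartingale \<and> (\<forall>i\<in>{k + 1..n}. integrable P (N i))" for SM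
    using assms(17) that by (intro value_function_eq_ess_inf_one_step_values[OF \<open>k < n\<close>]) auto
  then show ?thesis by blast
qed

end
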